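(* Let $m\ge 2$ and $n\ge 1$ be integers and let $\lambda\vdash n$. Then \[ P^{(m)}_{n,\lambda}(t)=\frac{|C(\lambda)|}{n}\,t^{\ell(\lambda)}\sum_{a=0}^{n-1}(-1)^a\,H_{n,a}(t)^{m-1}\,\chi^{[n-a,1^a]}_{\lambda}, \] where $H_{n,a}(t)=\prod_{k=-a}^{n-a-1}(t+k)$.
   Context: Here $\mathbb{S}_n$ is the symmetric group on $n$ letters. For a partition $\lambda\vdash n$, $\ell(\lambda)$ is its number of parts and $C(\lambda)\subset\mathbb{S}_n$ is the conjugacy class of permutations of cycle type $\lambda$. For $\theta,\mu\vdash n$, $\chi^{\theta}_{\mu}$ is the value at the class $C(\mu)$ of the irreducible character of $\mathbb{S}_n$ indexed by $\theta$ (standard convention, $\chi^{[n]}$ being the trivial character), and $[n-a,1^a]$ is the hook partition with first part $n-a$ followed by $a$ parts equal to $1$. For $\sigma\in\mathbb{S}_n$, $\mathrm{cyc}(\sigma)$ is its number of cycles. For $m\ge 2$, $\mathcal{M}_m(n,\lambda)$ is the set of tuples $(\phi,\sigma_0,\ldots,\sigma_{m-1})$ of permutations in $\mathbb{S}_n$ with $\phi\sigma_0\sigma_1\cdots\sigma_{m-1}=\mathrm{id}_n$, $\phi\in C(\lambda)$ and $\sigma_0$ an $n$-cycle. The genus of such a tuple is \[ g(\phi,\sigma_0,\ldots,\sigma_{m-1})=1+\tfrac12\Big((m-1)n-\ell(\lambda)-\sum_{i=0}^{m-1}\mathrm{cyc}(\sigma_i)\Big), \] and $\Gamma^{(m)}_{n,\lambda}(x)=\sum_{M\in\mathcal{M}_m(n,\lambda)}x^{g(M)}$.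 Finally, $P^{(m)}_{n,\lambda}(t)=t^{(m-1)n+1}\,\Gamma^{(m)}_{n,\lambda}(t^{-2})$. *)

theory Defs
  imports
    Complex_Main
    "HOL-Library.Multiset"
    "HOL-Library.Poly_Mapping"
    "HOL-Combinatorics.Permutations"
    "HOL-Combinatorics.Orbits"
begin

section \<open>Partitions and conjugacy classes of the symmetric group\<close>

text \<open>The symmetric group acts on \<open>{1..n}\<close>; its elements are the functions \<open>p\<close> with
  \<open>p permutes {1..n}\<close>, multiplied by composition.\<close>

definition is_partition :: "nat list \<Rightarrow> nat \<Rightarrow> bool" where
  "is_partition lam n \<longleftrightarrow> sorted_wrt (\<ge>) lam \<and> (\<forall>k\<in>set lam. 0 < k) \<and> sum_list lam = n"

definition hook :: "nat \<Rightarrow> nat \<Rightarrow> nat list" where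
  "hook n a = (n - a) # replicate a 1"

definition cycle_sets :: "nat \<Rightarrow> (nat \<Rightarrow> nat) \<Rightarrow> nat set set" where
  "cycle_sets n p = orbit p ` {1..n}"

definition cyc :: "nat \<Rightarrow> (nat \<Rightarrow> nat) \<Rightarrow> nat" where
  "cyc n p = card (cycle_sets n p)"

definition cycle_type :: "nat \<Rightarrow> (nat \<Rightarrow> nat) \<Rightarrow> nat multiset" where
  "cycle_type n p = image_mset card (mset_set (cycle_sets n p))"

definition conj_class :: "nat \<Rightarrow> nat list \<Rightarrow> (nat \<Rightarrow> nat) set" where
  "conj_class n lam = {p. p permutes {1..n} \<and> cycle_type n p = mset lam}"

section \<open>Irreducible characters via Specht modules\<close>

text \<open>The irreducible complex representation indexed by \<open>th\<close> is the Specht module: the span of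
  the polytabloids of shape \<open>th\<close> in the permutation module on the tabloids of shape \<open>th\<close>. For
  \<open>th = [n]\<close> there is a single tabloid, so this is the trivial representation.\<close>

definition diagram :: "nat list \<Rightarrow> (nat \<times> nat) set" where
  "diagram th = {(i, j). i < length th \<and> j < th ! i}"

text \<open>Only the values of a tableau on the cells of the diagram matter.\<close>

definition tableaux :: "nat list \<Rightarrow> (nat \<times> nat \<Rightarrow> nat) set" where
  "tableaux th = {T. bij_betw T (diagram th) {1..sum_list th}}"

text \<open>A tabloid, i.e. a tableau up to permutations within the rows, is encoded as the list of its
  sets of row entries.\<close>

type_synonym tabloid = "nat set list"

definition tabloid_of :: "nat list \<Rightarrow> (nat \<times> nat \<Rightarrow> nat) \<Rightarrow> tabloid" where
  "tabloid_of th T = map (\<lambda>i. {T (i, j) | j. j < th ! i}) [0..<length th]"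

definition column_stabilizer :: "nat list \<Rightarrow> (nat \<times> nat \<Rightarrow> nat) \<Rightarrow> (nat \<Rightarrow> nat) set" where
  "column_stabilizer th T = {p. p permutes {1..sum_list th} \<and>
     (\<forall>j. let col = {T (i, j) | i. (i, j) \<in> diagram th} in p ` col = col)}"

text \<open>The permutation modules live in the free complex vector space on all tabloids.\<close>

type_synonym tabloid_vec = "tabloid \<Rightarrow>\<^sub>0 complex"

definition scale_vec :: "complex \<Rightarrow> tabloid_vec \<Rightarrow> tabloid_vec" where
  "scale_vec c v = Poly_Mapping.map ((*) c) v"

lemma lookup_scale_vec [simp]:
  "Poly_Mapping.lookup (scale_vec c v) x = c * Poly_Mapping.lookup v x"
  unfolding scale_vec_def by (simp add: Poly_Mapping.map.rep_eq when_def)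

interpretation tabloid_space: vector_space scale_vec
  by unfold_locales (auto intro!: poly_mapping_eqI simp: lookup_add algebra_simps)

definition act :: "(nat \<Rightarrow> nat) \<Rightarrow> tabloid_vec \<Rightarrow> tabloid_vec" where
  "act p v = (\<Sum>x\<in>Poly_Mapping.keys v.
     Poly_Mapping.single (map (image p) x) (Poly_Mapping.lookup v x))"

definition polytabloid :: "nat list \<Rightarrow> (nat \<times> nat \<Rightarrow> nat) \<Rightarrow> tabloid_vec" where
  "polytabloid th T =
     (\<Sum>p\<in>column_stabilizer th T. Poly_Mapping.single (tabloid_of th (p \<circ> T)) (of_int (sign p)))"

definition specht :: "nat list \<Rightarrow> tabloid_vec set" where
  "specht th = tabloid_space.span (polytabloid th ` tableaux th)"

text \<open>The trace on a finite-dimensional subspace \<open>V\<close> of an endomorphism \<open>f\<close> preserving \<open>V\<close>,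
  computed in an arbitrary basis of \<open>V\<close>.\<close>

definition trace_on :: "tabloid_vec set \<Rightarrow> (tabloid_vec \<Rightarrow> tabloid_vec) \<Rightarrow> complex" where
  "trace_on V f =
     (let B = (SOME B. tabloid_space.independent B \<and> tabloid_space.span B = V)
      in \<Sum>b\<in>B. tabloid_space.representation B (f b) b)"

definition specht_character :: "nat list \<Rightarrow> (nat \<Rightarrow> nat) \<Rightarrow> complex" where
  "specht_character th p = trace_on (specht th) (act p)"

text \<open>The value \<open>\<chi>\<^sup>\<theta>\<^sub>\<mu>\<close> at an arbitrary representative of the class of cycle type \<open>mu\<close>.\<close>

definition irr_char :: "nat list \<Rightarrow> nat list \<Rightarrow> complex" where
  "irr_char th mu = specht_character th (SOME p. p \<in> conj_class (sum_list mu) mu)"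

section \<open>Factorizations and their genus\<close>

text \<open>A tuple \<open>(\<phi>, \<sigma>\<^sub>0, \<dots>, \<sigma>\<^sub>m\<^sub>-\<^sub>1)\<close> is encoded as a pair of \<open>\<phi>\<close> and a list of length \<open>m\<close>.\<close>

type_synonym perm_tuple = "(nat \<Rightarrow> nat) \<times> (nat \<Rightarrow> nat) list"

definition Maps :: "nat \<Rightarrow> nat \<Rightarrow> nat list \<Rightarrow> perm_tuple set" where
  "Maps m n lam = {(phi, ss). length ss = m \<and> (\<forall>s\<in>set ss. s permutes {1..n}) \<and>
     phi \<in> conj_class n lam \<and> ss ! 0 \<in> conj_class n [n] \<and> phi \<circ> foldr (\<circ>) ss id = id}"

definition genus :: "nat \<Rightarrow> nat \<Rightarrow> nat list \<Rightarrow> perm_tuple \<Rightarrow> rat" where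
  "genus m n lam M = 1 + 1 / 2 *
     ((of_nat m - 1) * of_nat n - of_nat (length lam) - (\<Sum>i<m. of_nat (cyc n (snd M ! i))))"

text \<open>On \<^term>\<open>Maps m n lam\<close> the genus is an integer, by comparing signs in the product relation,
  so the floor below does not round; it only changes the type of the exponent.\<close>

definition Gamma_fun :: "nat \<Rightarrow> nat \<Rightarrow> nat list \<Rightarrow> complex \<Rightarrow> complex" where
  "Gamma_fun m n lam x = (\<Sum>M\<in>Maps m n lam. x powi \<lfloor>genus m n lam M\<rfloor>)"

text \<open>As a function of \<open>t\<close>. In a factorization the power of \<open>t\<close> is \<open>\<ell>(\<lambda>) + \<Sum>\<^sub>i cyc \<sigma>\<^sub>i - 1 \<ge> 1\<close>,
  so this is a polynomial in \<open>t\<close> vanishing at 0; the definition also yields 0 there.\<close>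

definition P_fun :: "nat \<Rightarrow> nat \<Rightarrow> nat list \<Rightarrow> complex \<Rightarrow> complex" where
  "P_fun m n lam t = t ^ ((m - 1) * n + 1) * Gamma_fun m n lam (t powi (-2))"

definition H_fun :: "nat \<Rightarrow> nat \<Rightarrow> complex \<Rightarrow> complex" where
  "H_fun n a t = (\<Prod>k\<in>{- int a..int n - int a - 1}. t + of_int k)"

end

theory Submission
  imports Defs
begin

text \<open>
  Write \<open>\<chi>\<^sub>a\<close> for the character of the hook \<open>[n - a, 1\<^sup>a]\<close>. On a factorization the power of \<open>t\<close> is
  \<open>\<ell>(\<lambda>) + cyc(\<sigma>\<^sub>1) + \<dots> + cyc(\<sigma>\<^sub>m\<^sub>-\<^sub>1)\<close>, and \<open>\<sigma>\<^sub>0\<close> is determined by the other permutations, so one has to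
  sum these powers over the tuples for which \<open>\<sigma>\<^sub>1 \<dots> \<sigma>\<^sub>m\<^sub>-\<^sub>1 \<phi>\<close> is an \<open>n\<close>-cycle. Two facts about hooks
  suffice, and no completeness of the irreducible characters is needed.

  First, \<open>\<Sum>\<^sub>a (-1)\<^sup>a \<chi>\<^sub>a\<close> is \<open>n\<close> times the indicator function of the \<open>n\<close>-cycles. The polytabloids of the
  tableaux with corner entry 1, one for each set \<open>Y\<close> of entries below the corner, form a basis of
  the Specht module in which coordinates are coefficients at tabloids. The resulting formula for
  \<open>\<chi>\<^sub>a\<close> is a signed count of partial actions on such sets \<open>Y\<close>, and in the alternating sum a cycle
  that avoids 1 can be added to or removed from \<open>Y\<close>.

  Second, the central element \<open>\<Sum>\<^sub>\<sigma> t^cyc(\<sigma>) \<sigma>\<close> commutes with column antisymmetrization and hence maps a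
  polytabloid to a multiple of itself. The factor is the sum of \<open>sgn(q) t^cyc(q\<rho>)\<close> over column
  permutations \<open>q\<close> and row permutations \<open>\<rho>\<close>. Since the first row and the first column share only the
  corner, \<open>cyc(q\<rho>) = cyc(q) + cyc(\<rho>) - 1\<close>, and the sum factors as \<open>H\<^sub>n\<^sub>,\<^sub>a(t)\<close>.
\<close>

section \<open>Permutations\<close>

text \<open>\<open>Y\<close> and its image under \<open>f\<close> have complements of equal size in
  \<open>Z\<close>, and any bijection between these complements completes \<open>f\<close>.\<close>

lemma permutes_extension:
  assumes "finite Z" "Y \<subseteq> Z" "f ` Y \<subseteq> Z" "inj_on f Y"
  obtains p where "p permutes Z" "\<And>y. y \<in> Y \<Longrightarrow> p y = f y"
proof -
  have "finite Y" using assms(1,2) finite_subset by blast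
  then have "card (Z - Y) = card (Z - f ` Y)"
    using assms by (simp add: card_Diff_subset card_image)
  then obtain h where h: "bij_betw h (Z - Y) (Z - f ` Y)"
    using finite_same_card_bij[of "Z - Y" "Z - f ` Y"] assms(1) by auto
  define p where "p x = (if x \<in> Y then f x else if x \<in> Z then h x else x)" for x
  have "bij_betw p Y (f ` Y)"
    using assms(4) by (auto simp: bij_betw_def inj_on_def p_def)
  moreover have "bij_betw p (Z - Y) (Z - f ` Y)"
    using h bij_betw_cong[of "Z - Y" p h] by (simp add: p_def)
  ultimately have "bij_betw p (Y \<union> (Z - Y)) (f ` Y \<union> (Z - f ` Y))"
    by (rule bij_betw_combine) auto
  moreover have "Y \<union> (Z - Y) = Z" "f ` Y \<union> (Z - f ` Y) = Z" using assms by auto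
  ultimately have "p permutes Z"
    using assms(2) by (intro bij_imp_permutes) (auto simp: p_def)
  then show thesis using that by (simp add: p_def)
qed

lemma permutes_mapping:
  assumes "finite Z" "inj_on x I" "inj_on y I" "x ` I \<subseteq> Z" "y ` I \<subseteq> Z"
  obtains p where "p permutes Z" "\<And>i. i \<in> I \<Longrightarrow> p (x i) = y i"
proof -
  let ?f = "y \<circ> the_inv_into I x"
  have f: "?f (x i) = y i" if "i \<in> I" for i
    using the_inv_into_f_f[OF assms(2) that] by simp
  have "?f ` x ` I = y ` I" unfolding image_image by (intro image_cong f refl)
  moreover have "inj_on ?f (x ` I)"
    using assms(3) by (intro comp_inj_on inj_on_the_inv_into assms(2)) (simp add: the_inv_into_onto assms(2))
  ultimately obtain p where "p permutes Z" "\<And>z. z \<in> x ` I \<Longrightarrow> p z = ?f z"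
    using permutes_extension[of Z "x ` I" ?f] assms by metis
  then show thesis using that f by (metis imageI)
qed

text \<open>Once all letters but one have prescribed values, the last value is forced. Column
  permutations are thus determined by their effect below the corner, and legged permutations by
  their leg.\<close>

lemma permutes_insert_eqI:
  assumes "p permutes insert z Y" "q permutes insert z Y" "\<And>y. y \<in> Y \<Longrightarrow> p y = q y"
  shows "p = q"
proof -
  have "inv q \<circ> p permutes insert z Y"
    using assms by (intro permutes_compose permutes_inv)
  then have "inv q \<circ> p permutes {z}"
    by (rule permutes_superset) (use assms(3) permutes_inverses[OF assms(2)] in auto)
  then have *: "inv q \<circ> p = id" by simp
  have "p = q \<circ> (inv q \<circ> p)" unfolding o_assoc permutes_inv_o[OF assms(2)] by simp
  then show ?thesis unfolding * by simp
qed

text \<open>Right multiplication by the transposition permutes the summation range, keeps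
  \<open>F\<close> and flips the sign, so the sum equals its own negative. The Garnir relation and
  the vanishing case of the submodule lemma both come down to this cancellation.\<close>

lemma sum_sign_eq_0:
  fixes F :: "('a \<Rightarrow> 'a) \<Rightarrow> complex"
  assumes "finite X" "u \<in> X" "v \<in> X" "u \<noteq> v"
    and "\<And>p. p permutes X \<Longrightarrow> F (p \<circ> transpose u v) = F p"
  shows "(\<Sum>p | p permutes X. of_int (sign p) * F p) = 0" (is "?S = 0")
proof -
  have "?S = (\<Sum>p | p permutes X. of_int (sign (p \<circ> transpose u v)) * F (p \<circ> transpose u v))"
    by (rule sum_permutations_compose_right) (use assms in \<open>simp add: permutes_swap_id\<close>)
  also have "\<dots> = (\<Sum>p | p permutes X. - (of_int (sign p) * F p))"
  proof (intro sum.cong refl)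
    fix p assume "p \<in> {p. p permutes X}"
    then have p: "p permutes X" by simp
    then have "permutation p" using assms(1) permutation_permutes by blast
    then have "sign (p \<circ> transpose u v) = - sign p"
      using assms(4) by (simp add: sign_compose permutation_swap_id sign_swap_id)
    then show "of_int (sign (p \<circ> transpose u v)) * F (p \<circ> transpose u v) =
        - (of_int (sign p) * F p)"
      using assms(5)[OF p] by simp
  qed
  also have "\<dots> = - ?S" by (simp add: sum_negf)
  finally show ?thesis by simp
qed

lemma sign_compose_permutes:
  assumes "finite S" "p permutes S" "q permutes S"
  shows "sign (p \<circ> q) = sign p * sign q"
  using assms permutation_permutes by (intro sign_compose) auto

lemma sign_conj:
  assumes "permutation p" "permutation g"
  shows "sign (g \<circ> p \<circ> inv g) = sign p"
proof -
  have "sign (g \<circ> p \<circ> inv g) = sign g * sign p * sign g"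
    using assms by (simp add: sign_compose permutation_compose permutation_inverse sign_inverse)
  also have "\<dots> = sign p" using sign_idempotent[of g] by (simp add: mult.commute)
  finally show ?thesis .
qed

lemma permutes_conj_image:
  fixes g :: "'a \<Rightarrow> 'a"
  assumes "p permutes X" "bij g"
  shows "g \<circ> p \<circ> inv g permutes g ` X"
proof -
  have g: "g permutes UNIV" using assms(2) by (intro bij_imp_permutes) auto
  then have "g \<circ> p \<circ> inv g permutes UNIV"
    using permutes_subset[OF assms(1), of UNIV] by (intro permutes_compose permutes_inv) auto
  then show ?thesis
  proof (rule permutes_superset)
    fix y assume "y \<in> UNIV - g ` X"
    then have "inv g y \<notin> X" using permutes_inverses[OF g] by (metis DiffD2 image_eqI)
    then show "(g \<circ> p \<circ> inv g) y = y"
      using permutes_not_in[OF assms(1)] permutes_inverses[OF g] by simp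
  qed
qed

section \<open>Counting cycles\<close>

definition ncyc :: "'a set \<Rightarrow> ('a \<Rightarrow> 'a) \<Rightarrow> nat" where
  "ncyc S p = card (orbit p ` S)"

lemma cyc_eq_ncyc: "cyc n p = ncyc {1..n} p"
  by (simp add: cyc_def ncyc_def cycle_sets_def)

section \<open>Inserting one letter into the cycles of a permutation\<close>

lemma orbit_subsetI:
  assumes "x \<in> C" and "\<And>y. y \<in> C \<Longrightarrow> p y \<in> C"
  shows "orbit p x \<subseteq> C"
proof
  fix y assume "y \<in> orbit p x"
  then show "y \<in> C" by induct (auto simp: assms)
qed

lemma self_in_orbit_permutes:
  assumes "p permutes S" "finite S"
  shows "x \<in> orbit p x"
  using assms permutation_permutes permutation_self_in_orbit by metis

lemma orbit_eqI_permutes: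
  assumes "p permutes S" "finite S" "y \<in> orbit p x"
  shows "orbit p y = orbit p x"
  using assms cyclic_on_orbit orbit_cyclic_eq3 by metis

text \<open>As \<open>q\<close> fixes \<open>a\<close>, left multiplication by the transposition
  redirects the preimage of \<open>b\<close> to \<open>a\<close> and sends \<open>a\<close> to
  \<open>b\<close>: the letter \<open>a\<close> is spliced into the cycle of \<open>b\<close> just
  before \<open>b\<close>, and the other cycles stay.\<close>

lemma orbit_transpose_comp:
  assumes q: "q permutes F" and fin: "finite F" and a: "a \<notin> F" and b: "b \<in> F" and x: "x \<in> F"
  shows "orbit (transpose a b \<circ> q) x =
    (if b \<in> orbit q x then insert a (orbit q x) else orbit q x)"
    and "orbit (transpose a b \<circ> q) a = insert a (orbit q b)"
proof -
  let ?p = "transpose a b \<circ> q"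
  have sub: "orbit q y \<subseteq> F" if "y \<in> F" for y
    using permutes_orbit_subset[OF q that] .
  have p: "?p permutes insert a F"
    using q b by (intro permutes_compose permutes_swap_id) (auto intro: permutes_subset)
  have fin': "finite (insert a F)" using fin by simp
  have qa: "q a = a" using q a by (rule permutes_not_in)
  have pa: "?p a = b" using qa by simp
  have bb: "b \<in> orbit ?p b" by (rule self_in_orbit_permutes[OF p fin'])
  have pb: "orbit ?p b = insert a (orbit q b)"
  proof
    show "orbit ?p b \<subseteq> insert a (orbit q b)"
    proof (rule orbit_subsetI)
      show "b \<in> insert a (orbit q b)" using self_in_orbit_permutes[OF q fin] by auto
      fix y assume "y \<in> insert a (orbit q b)"
      then show "?p y \<in> insert a (orbit q b)"
        using pa self_in_orbit_permutes[OF q fin, of b] orbit.step[of y q b]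
        by (auto simp: transpose_def)
    qed
    have "y \<in> orbit ?p b" if "y \<in> orbit q b" for y
      using that
    proof induct
      case base
      have "q b \<noteq> a" using a b permutes_in_image[OF q] by metis
      then show ?case using bb orbit.base[of ?p b] by (cases "q b = b") (simp_all del: o_apply add: o_apply[of _ q b])
    next
      case (step y)
      have "y \<in> F" using step(1) sub[OF b] by auto
      then have "q y \<noteq> a" using a permutes_in_image[OF q] by metis
      then show ?case using bb orbit.step[OF step(2)]
        by (cases "q y = b") (simp_all del: o_apply add: o_apply[of _ q y])
    qed
    moreover have "orbit ?p a = orbit ?p b"
      using permutation_orbit_step[of ?p a] pa p fin' permutation_permutes by metis
    then have "a \<in> orbit ?p b" using self_in_orbit_permutes[OF p fin', of a] by simp
    ultimately show "insert a (orbit q b) \<subseteq> orbit ?p b" by auto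
  qed
  show "orbit ?p a = insert a (orbit q b)"
    using pb permutation_orbit_step[of ?p a] pa p fin' permutation_permutes by metis
  show "orbit ?p x = (if b \<in> orbit q x then insert a (orbit q x) else orbit q x)"
  proof (cases "b \<in> orbit q x")
    case True
    then have eq: "orbit q b = orbit q x" by (rule orbit_eqI_permutes[OF q fin])
    have "x \<in> orbit ?p b" using pb eq self_in_orbit_permutes[OF q fin, of x] by auto
    then have "orbit ?p x = orbit ?p b" by (rule orbit_eqI_permutes[OF p fin'])
    then show ?thesis using True pb eq by simp
  next
    case False
    have "orbit ?p x = orbit q x"
    proof (rule orbit_cong)
      show "x \<in> orbit q x" by (rule self_in_orbit_permutes[OF q fin])
      fix s assume s: "s \<in> orbit q x"
      then have "q s \<in> orbit q x" by (rule orbit.step)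
      then have "q s \<noteq> b" "q s \<noteq> a" using False sub[OF x] a by auto
      then show "?p s = q s" by simp
    qed
    then show ?thesis using False by simp
  qed
qed

text \<open>The one-letter recursion behind the cycle counts below: \<open>a\<close> is a new fixed
  point if \<open>a = b\<close>, and otherwise it enlarges an existing cycle.\<close>

lemma ncyc_insert:
  assumes q: "q permutes F" and fin: "finite F" and a: "a \<notin> F" and b: "b \<in> insert a F"
  shows "ncyc (insert a F) (transpose a b \<circ> q) = ncyc F q + (if a = b then 1 else 0)"
proof -
  have sub: "orbit q y \<subseteq> F" if "y \<in> F" for y
    using permutes_orbit_subset[OF q that] .
  show ?thesis
  proof (cases "a = b")
    case True
    have "orbit q a = {a}"
      using permutes_not_in[OF q a] by (simp add: orbit_eq_singleton_iff)
    moreover have "{a} \<notin> orbit q ` F" using sub a by auto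
    ultimately show ?thesis using True fin by (simp add: ncyc_def)
  next
    case False
    then have b: "b \<in> F" using b by simp
    let ?p = "transpose a b \<circ> q"
    \<comment> \<open>\<open>g\<close> takes cycles of \<open>q\<close> to cycles of the product. It
      is injective because \<open>a\<close> lies in no orbit of a letter of \<open>F\<close> and can
      be removed again.\<close>
    define g where "g C = (if b \<in> C then insert a C else C)" for C
    have "b \<in> orbit q b" by (rule self_in_orbit_permutes[OF q fin])
    then have "orbit ?p a = g (orbit q b)"
      using orbit_transpose_comp(2)[OF q fin a b b] by (simp add: g_def)
    moreover have "orbit ?p x = g (orbit q x)" if "x \<in> F" for x
      using orbit_transpose_comp(1)[OF q fin a b that] by (simp add: g_def)
    ultimately have "orbit ?p ` insert a F = g ` (orbit q ` F)"
      using b by (auto simp: image_image)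
    moreover have "inj_on g (orbit q ` F)"
    proof (rule inj_onI)
      fix C D assume "C \<in> orbit q ` F" "D \<in> orbit q ` F" "g C = g D"
      moreover from this have "a \<notin> C" "a \<notin> D" using sub a by auto
      ultimately show "C = D" unfolding g_def by (auto split: if_splits)
    qed
    ultimately show ?thesis using False by (simp add: ncyc_def card_image)
  qed
qed

section \<open>Generating functions and signs by number of cycles\<close>

lemma permutes_insertE:
  assumes "p permutes insert a S"
  obtains b q where "p = transpose a b \<circ> q" "b \<in> insert a S" "q permutes S"
  using assms permutes_insert[of a S] by (auto simp: set_eq_iff image_iff)

text \<open>Each permutation of the larger set arises once from a permutation of the smaller one and
  a choice of \<open>b\<close>. The choice \<open>b = a\<close> contributes a factor
  \<open>t\<close>, the other \<open>card S\<close> choices a factor 1.\<close>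

lemma sum_power_ncyc:
  fixes t :: "'b :: comm_ring_1"
  assumes "finite S"
  shows "(\<Sum>p | p permutes S. t ^ ncyc S p) = (\<Prod>j<card S. t + of_nat j)"
  using assms
proof (induction S)
  case empty
  then show ?case by (simp add: ncyc_def)
next
  case (insert a S)
  have "(\<Sum>p | p permutes insert a S. t ^ ncyc (insert a S) p) =
      (\<Sum>b\<in>insert a S. \<Sum>q | q permutes S. t ^ ncyc (insert a S) (transpose a b \<circ> q))"
    by (rule sum_over_permutations_insert) (use insert in auto)
  also have "\<dots> = (\<Sum>b\<in>insert a S. \<Sum>q | q permutes S. t ^ (if a = b then 1 else 0) * t ^ ncyc S q)"
    by (intro sum.cong refl) (use insert in \<open>simp add: ncyc_insert power_add\<close>)
  also have "\<dots> = (\<Sum>b\<in>insert a S. (if a = b then t else 1)) * (\<Prod>j<card S. t + of_nat j)"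
    unfolding sum_distrib_right
    by (intro sum.cong refl) (auto simp: insert.IH[symmetric] sum_distrib_left)
  also have "(\<Sum>b\<in>insert a S. (if a = b then t else 1)) = t + of_nat (card S)"
  proof -
    have "(\<Sum>b\<in>S. (if a = b then t else 1)) = (\<Sum>b\<in>S. 1)"
      by (rule sum.cong) (use insert in auto)
    then show ?thesis using insert by simp
  qed
  finally show ?case using insert by (simp add: mult.commute)
qed

text \<open>Inserting a letter either adds a cycle along with the letter, which keeps both sides, or
  multiplies by a genuine transposition, which flips both.\<close>

lemma sign_eq_ncyc:
  assumes "finite S" "p permutes S"
  shows "sign p = (- 1) ^ (card S + ncyc S p)"
  using assms
proof (induction S arbitrary: p)
  case empty
  then show ?case by (simp add: ncyc_def)
next
  case (insert a S)
  obtain b q where p: "p = transpose a b \<circ> q" "b \<in> insert a S" "q permutes S"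
    using insert.prems by (rule permutes_insertE)
  have "permutation q" using p(3) insert.hyps permutation_permutes by auto
  then have "sign p = sign (transpose a b) * sign q"
    unfolding p(1) by (intro sign_compose permutation_swap_id)
  then show ?case
    using insert.IH[OF p(3)] insert.hyps p(2)
    by (simp add: p(1) ncyc_insert[OF p(3) insert.hyps p(2)] sign_swap_id del: o_apply)
qed

lemma sum_sign_power_ncyc:
  fixes t :: "'b :: comm_ring_1"
  assumes "finite S"
  shows "(\<Sum>p | p permutes S. of_int (sign p) * t ^ ncyc S p) = (\<Prod>j<card S. t - of_nat j)"
proof -
  have "(\<Sum>p | p permutes S. of_int (sign p) * t ^ ncyc S p) =
      (- 1) ^ card S * (\<Sum>p | p permutes S. (- t) ^ ncyc S p)"
    unfolding sum_distrib_left
    by (intro sum.cong refl)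
      (simp add: sign_eq_ncyc[OF assms] power_add power_minus[of t] mult.assoc)
  also have "\<dots> = (\<Prod>j<card S. (- 1) * (- t + of_nat j))"
    unfolding sum_power_ncyc[OF assms] prod.distrib by simp
  finally show ?thesis by simp
qed

text \<open>\<open>R\<close> and \<open>insert x D\<close> meet only in \<open>x\<close>. A letter
  of \<open>D\<close> is peeled off \<open>p\<close> by a transposition on the left, which also
  stands on the left of \<open>p \<circ> rho\<close>, so both cycle counts change alike. The
  \<open>Suc\<close> comes from the base case, where \<open>p\<close> is the identity with the
  single cycle of \<open>x\<close>.\<close>

lemma ncyc_comp:
  assumes "finite R" "x \<in> R" "rho permutes R" "finite D" "D \<inter> R = {}" "p permutes insert x D"
  shows "Suc (ncyc (R \<union> D) (p \<circ> rho)) = ncyc R rho + ncyc (insert x D) p"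
  using assms(4-6)
proof (induction D arbitrary: p)
  case empty
  then show ?case by (simp add: ncyc_def)
next
  case (insert a D)
  have "p permutes insert a (insert x D)" using insert.prems by (simp add: insert_commute)
  then obtain b q where p: "p = transpose a b \<circ> q" "b \<in> insert a (insert x D)"
      "q permutes insert x D"
    by (rule permutes_insertE)
  have a: "a \<notin> insert x D" "a \<notin> R \<union> D" using insert assms(2) by auto
  have "q permutes R \<union> D" using p(3) by (rule permutes_subset) (use assms(2) in auto)
  moreover have "rho permutes R \<union> D" using assms(3) by (rule permutes_subset) auto
  ultimately have "q \<circ> rho permutes R \<union> D" by (intro permutes_compose)
  then have "ncyc (insert a (R \<union> D)) (transpose a b \<circ> (q \<circ> rho)) =
      ncyc (R \<union> D) (q \<circ> rho) + (if a = b then 1 else 0)"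
    by (rule ncyc_insert) (use a p(2) assms insert.hyps in auto)
  moreover have "ncyc (insert a (insert x D)) p = ncyc (insert x D) q + (if a = b then 1 else 0)"
    unfolding p(1) by (rule ncyc_insert) (use a p insert.hyps in auto)
  moreover have "Suc (ncyc (R \<union> D) (q \<circ> rho)) = ncyc R rho + ncyc (insert x D) q"
    by (rule insert.IH) (use insert.prems p in auto)
  ultimately show ?case by (simp add: p(1) comp_assoc insert_commute del: o_apply)
qed

lemma ncyc_eq_of_orbits:
  assumes "finite S" "p permutes S" "p' permutes S" "f permutes S"
    and "\<And>x. x \<in> S \<Longrightarrow> p' (f x) = f (p x)"
  shows "orbit p' ` S = (`) f ` (orbit p ` S)" "ncyc S p' = ncyc S p"
proof -
  have "orbit p' (f x) = f ` orbit p x" if "x \<in> S" for x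
    using permutes_orbit_subset[OF assms(2) that] that assms
    by (intro orbit_inverse[symmetric] self_in_orbit_permutes[of p S]) auto
  moreover have "orbit p' ` S = orbit p' ` (f ` S)" using permutes_image[OF assms(4)] by simp
  ultimately show eq: "orbit p' ` S = (`) f ` (orbit p ` S)"
    by (auto simp: image_image)
  have "inj_on ((`) f) (orbit p ` S)"
    using permutes_inj[OF assms(4)] by (simp add: inj_on_def inj_image_eq_iff)
  then show "ncyc S p' = ncyc S p" by (simp add: ncyc_def eq card_image)
qed

lemma ncyc_conj:
  assumes "finite S" "p permutes S" "h permutes S"
  shows "ncyc S (h \<circ> p \<circ> inv h) = ncyc S p"
  by (rule ncyc_eq_of_orbits[where f = h])
    (use assms permutes_inverses[OF assms(3)] in \<open>auto intro!: permutes_compose permutes_inv\<close>)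

section \<open>The permutation action and traces\<close>

lemma scale_vec_single [simp]:
  "scale_vec c (Poly_Mapping.single x d) = Poly_Mapping.single x (c * d)"
  by (rule poly_mapping_eqI) (simp add: lookup_single when_def)

text \<open>A summation range larger than the support lets two vectors share one index set in the
  proof of linearity.\<close>

lemma act_eq_sum:
  assumes "finite A" "Poly_Mapping.keys v \<subseteq> A"
  shows "act p v = (\<Sum>x\<in>A. Poly_Mapping.single (map (image p) x) (Poly_Mapping.lookup v x))"
  unfolding act_def
  by (rule sum.mono_neutral_left[OF assms]) (simp add: in_keys_iff)

lemma act_single [simp]:
  "act p (Poly_Mapping.single x c) = Poly_Mapping.single (map (image p) x) c"
  by (subst act_eq_sum[of "{x}"]) auto

lemma module_hom_act: "module_hom scale_vec scale_vec (act p)"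
proof (intro module_hom.intro tabloid_space.module_axioms module_hom_axioms.intro)
  fix v w :: tabloid_vec and c
  let ?A = "Poly_Mapping.keys v \<union> Poly_Mapping.keys w"
  show "act p (v + w) = act p v + act p w"
    using Poly_Mapping.keys_add[of v w]
    by (simp add: act_eq_sum[of ?A] lookup_add single_add sum.distrib)
  have "Poly_Mapping.keys (scale_vec c v) \<subseteq> Poly_Mapping.keys v"
    by (auto simp: in_keys_iff)
  then show "act p (scale_vec c v) = scale_vec c (act p v)"
    by (simp add: act_eq_sum[of "Poly_Mapping.keys v"] tabloid_space.scale_sum_right)
qed

lemmas act_add = module_hom.add[OF module_hom_act]
  and act_scale = module_hom.scale[OF module_hom_act]
  and act_sum = module_hom.sum[OF module_hom_act]

lemma act_act: "act p (act q v) = act (p \<circ> q) v"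
proof -
  have "act p (act q v) = (\<Sum>x\<in>Poly_Mapping.keys v.
      Poly_Mapping.single (map (image (p \<circ> q)) x) (Poly_Mapping.lookup v x))"
    unfolding act_def[of q] by (simp add: act_sum image_comp o_def)
  then show ?thesis by (simp add: act_def)
qed

lemma act_id: "act id v = v"
  by (rule poly_mapping_eqI)
    (simp add: act_def lookup_sum lookup_single when_def in_keys_iff)

lemma module_hom_lookup: "module_hom scale_vec (*) (\<lambda>v. Poly_Mapping.lookup v k)"
proof (intro module_hom.intro tabloid_space.module_axioms module_hom_axioms.intro)
  show "module ((*) :: complex \<Rightarrow> _)" by unfold_locales (auto simp: algebra_simps)
qed (auto simp: lookup_add)

section \<open>Traces computed from generating vectors with coordinate functionals\<close>

lemma finite_basis_of_finite_span:
  assumes "finite G" "tabloid_space.independent B" "tabloid_space.span B = tabloid_space.span G"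
  shows "finite B"
  using tabloid_space.independent_span_bound[OF assms(1,2)] assms(3)
    tabloid_space.span_superset[of B] by auto

lemma trace_basis:
  assumes "tabloid_space.subspace V"
  obtains B where "tabloid_space.independent B" "tabloid_space.span B = V"
    "\<And>f. trace_on V f = (\<Sum>b\<in>B. tabloid_space.representation B (f b) b)"
proof -
  define B where "B = (SOME B. tabloid_space.independent B \<and> tabloid_space.span B = V)"
  obtain B0 where "B0 \<subseteq> V" "tabloid_space.independent B0" "V \<subseteq> tabloid_space.span B0"
    using tabloid_space.maximal_independent_subset by blast
  moreover from this have "tabloid_space.span B0 \<subseteq> V"
    using assms tabloid_space.span_minimal by blast
  ultimately have "tabloid_space.independent B0 \<and> tabloid_space.span B0 = V" by blast
  then have "tabloid_space.independent B \<and> tabloid_space.span B = V"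
    unfolding B_def by (rule someI)
  moreover have "trace_on V f = (\<Sum>b\<in>B. tabloid_space.representation B (f b) b)" for f
    by (simp add: trace_on_def Let_def flip: B_def)
  ultimately show thesis using that by metis
qed

text \<open>Expanding \<open>f b\<close> by the frame and interchanging the sums makes the basis
  coordinates of \<open>w i\<close> recombine to \<open>w i\<close>, so the basis disappears from
  the result. The basis chosen inside \<open>trace_on\<close> is thereby replaced by explicit
  vectors \<open>w i\<close> with functionals \<open>phi i\<close>.\<close>

lemma trace_on_frame:
  assumes V: "tabloid_space.subspace V"
    and f: "module_hom scale_vec scale_vec f" and fV: "\<And>v. v \<in> V \<Longrightarrow> f v \<in> V"
    and I: "finite I" and w: "\<And>i. i \<in> I \<Longrightarrow> w i \<in> V"
    and phi: "\<And>i. i \<in> I \<Longrightarrow> module_hom scale_vec (*) (phi i)"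
    and frame: "\<And>v. v \<in> V \<Longrightarrow> v = (\<Sum>i\<in>I. scale_vec (phi i v) (w i))"
  shows "trace_on V f = (\<Sum>i\<in>I. phi i (f (w i)))"
proof -
  obtain B where B: "tabloid_space.independent B" "tabloid_space.span B = V"
    and trace: "trace_on V f = (\<Sum>b\<in>B. tabloid_space.representation B (f b) b)"
    using trace_basis[OF V] by metis
  let ?rep = "tabloid_space.representation B"
  \<comment> \<open>The frame generates \<open>V\<close> by finitely many vectors, which makes the
    unspecified basis \<open>B\<close> finite.\<close>
  have "V = tabloid_space.span (w ` I)"
  proof
    show "V \<subseteq> tabloid_space.span (w ` I)"
    proof
      fix v assume "v \<in> V"
      then have "v = (\<Sum>i\<in>I. scale_vec (phi i v) (w i))" by (rule frame)
      also have "\<dots> \<in> tabloid_space.span (w ` I)"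
        by (intro tabloid_space.span_sum tabloid_space.span_scale tabloid_space.span_base) auto
      finally show "v \<in> tabloid_space.span (w ` I)" .
    qed
    show "tabloid_space.span (w ` I) \<subseteq> V"
      using w by (intro tabloid_space.span_minimal V) auto
  qed
  then have finB: "finite B" using finite_basis_of_finite_span[of "w ` I"] I B by simp
  have inV: "b \<in> V" if "b \<in> B" for b using that B(2) tabloid_space.span_base by blast
  have rep: "?rep (f b) b = (\<Sum>i\<in>I. phi i (f b) * ?rep (w i) b)" if "b \<in> B" for b
  proof -
    have "?rep (f b) b = ?rep (\<Sum>i\<in>I. scale_vec (phi i (f b)) (w i)) b"
      using frame[OF fV[OF inV[OF that]]] by simp
    also have "\<dots> = (\<Sum>i\<in>I. ?rep (scale_vec (phi i (f b)) (w i)) b)"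
      using w B
      by (subst tabloid_space.representation_sum[OF B(1)]) (auto intro: tabloid_space.span_scale)
    also have "\<dots> = (\<Sum>i\<in>I. phi i (f b) * ?rep (w i) b)"
      using w B by (intro sum.cong refl) (simp add: tabloid_space.representation_scale)
    finally show ?thesis .
  qed
  have "trace_on V f = (\<Sum>i\<in>I. \<Sum>b\<in>B. phi i (f b) * ?rep (w i) b)"
    unfolding trace by (subst sum.swap) (simp add: rep)
  also have "\<dots> = (\<Sum>i\<in>I. phi i (f (\<Sum>b\<in>B. scale_vec (?rep (w i) b) b)))"
    by (intro sum.cong refl)
      (simp add: module_hom.sum[OF phi] module_hom.sum[OF f] module_hom.scale[OF phi]
        module_hom.scale[OF f] mult.commute[of _ "?rep _ _"])
  also have "\<dots> = (\<Sum>i\<in>I. phi i (f (w i)))"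
  proof (intro sum.cong refl)
    fix i assume "i \<in> I"
    then have "(\<Sum>b\<in>B. scale_vec (?rep (w i) b) b) = w i"
      using w B finB by (intro tabloid_space.sum_representation_eq) auto
    then show "phi i (f (\<Sum>b\<in>B. scale_vec (?rep (w i) b) b)) = phi i (f (w i))" by simp
  qed
  finally show ?thesis .
qed

section \<open>Specht modules of hook shape\<close>

text \<open>A tabloid of hook shape is determined by the entries \<open>x 1, \<dots>, x a\<close> of its first column below
  the corner, and the polytabloid of a tableau by the whole first column \<open>x 0, \<dots>, x a\<close>, since
  the other columns have at most one cell.\<close>

definition hook_tabloid :: "nat \<Rightarrow> nat \<Rightarrow> (nat \<Rightarrow> nat) \<Rightarrow> tabloid" where
  "hook_tabloid n a x = ({1..n} - x ` {1..a}) # map (\<lambda>i. {x i}) [1..<Suc a]"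

definition columns :: "nat \<Rightarrow> nat \<Rightarrow> (nat \<Rightarrow> nat) set" where
  "columns n a = {x. inj_on x {0..a} \<and> x ` {0..a} \<subseteq> {1..n}}"

definition column_vec :: "nat \<Rightarrow> nat \<Rightarrow> (nat \<Rightarrow> nat) \<Rightarrow> tabloid_vec" where
  "column_vec n a x = (\<Sum>p | p permutes x ` {0..a}.
     Poly_Mapping.single (hook_tabloid n a (p \<circ> x)) (of_int (sign p)))"

section \<open>Translation of hook tableaux into their first columns\<close>

lemma hook_tabloid_eq_iff:
  "hook_tabloid n a x = hook_tabloid n a y \<longleftrightarrow> (\<forall>i\<in>{1..a}. x i = y i)"
proof
  assume "hook_tabloid n a x = hook_tabloid n a y"
  then show "\<forall>i\<in>{1..a}. x i = y i" by (auto simp: hook_tabloid_def simp del: upt_Suc)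
next
  assume *: "\<forall>i\<in>{1..a}. x i = y i"
  then have "x ` {1..a} = y ` {1..a}" by (intro image_cong) auto
  with * show "hook_tabloid n a x = hook_tabloid n a y"
    by (auto simp: hook_tabloid_def simp del: upt_Suc)
qed

lemma map_image_hook_tabloid:
  assumes "p permutes {1..n}"
  shows "map (image p) (hook_tabloid n a x) = hook_tabloid n a (p \<circ> x)"
proof -
  have "p ` ({1..n} - x ` {1..a}) = {1..n} - (p \<circ> x) ` {1..a}"
    unfolding image_set_diff[OF permutes_inj[OF assms]] permutes_image[OF assms] image_comp ..
  then show ?thesis by (simp add: hook_tabloid_def del: upt_Suc)
qed

lemma diagram_hook:
  assumes "a < n"
  shows "diagram (hook n a) = (\<lambda>i. (i, 0)) ` {0..a} \<union> (\<lambda>j. (0, j)) ` {1..<n - a}"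
proof -
  have "(hook n a) ! i = (if i = 0 then n - a else 1)" if "i \<le> a" for i
    using that by (cases i) (auto simp: hook_def)
  moreover have "length (hook n a) = Suc a" by (simp add: hook_def)
  ultimately show ?thesis using assms
    by (auto simp: diagram_def image_iff less_Suc_eq_le split: if_splits)
qed

lemma sum_list_hook: "a < n \<Longrightarrow> sum_list (hook n a) = n"
  by (simp add: hook_def sum_list_replicate)

lemma column_of_tableau:
  assumes "a < n" "T \<in> tableaux (hook n a)"
  shows "(\<lambda>i. T (i, 0)) \<in> columns n a"
proof -
  have T: "inj_on T (diagram (hook n a))" "T ` diagram (hook n a) = {1..n}"
    using assms by (simp_all add: tableaux_def sum_list_hook bij_betw_def)
  have cell: "(i, 0) \<in> diagram (hook n a)" if "i \<in> {0..a}" for i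
    unfolding diagram_hook[OF assms(1)] using that by blast
  have "inj_on (\<lambda>i. T (i, 0)) {0..a}"
    by (rule inj_onI) (use inj_onD[OF T(1) _ cell cell] in blast)
  moreover have "T (i, 0) \<in> {1..n}" if "i \<in> {0..a}" for i
    using imageI[OF cell[OF that], of T] T(2) by simp
  ultimately show ?thesis by (auto simp: columns_def)
qed

lemma tableau_of_column:
  assumes "a < n" "x \<in> columns n a"
  shows "\<exists>T\<in>tableaux (hook n a). \<forall>i\<le>a. T (i, 0) = x i"
proof -
  have x: "inj_on x {0..a}" "x ` {0..a} \<subseteq> {1..n}" using assms by (auto simp: columns_def)
  have "card ({1..n} - x ` {0..a}) = card {1..<n - a}"
    using x by (simp add: card_Diff_subset card_image)
  then obtain h where h: "bij_betw h {1..<n - a} ({1..n} - x ` {0..a})"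
    using finite_same_card_bij[of "{1..<n - a}" "{1..n} - x ` {0..a}"] by auto
  define T where "T c = (if snd c = 0 then x (fst c) else h (snd c))" for c :: "nat \<times> nat"
  have "T ` (\<lambda>i. (i, 0)) ` {0..a} = x ` {0..a}"
    unfolding image_image by (intro image_cong) (auto simp: T_def)
  then have "bij_betw T ((\<lambda>i. (i, 0)) ` {0..a}) (x ` {0..a})"
    using x by (auto simp: bij_betw_def inj_on_def T_def)
  moreover have "T ` (\<lambda>j. (0, j)) ` {1..<n - a} = h ` {1..<n - a}"
    unfolding image_image by (intro image_cong) (auto simp: T_def)
  then have "bij_betw T ((\<lambda>j. (0, j)) ` {1..<n - a}) ({1..n} - x ` {0..a})"
    using h by (auto simp: bij_betw_def inj_on_def T_def)
  ultimately have "bij_betw T (diagram (hook n a)) (x ` {0..a} \<union> ({1..n} - x ` {0..a}))"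
    unfolding diagram_hook[OF assms(1)] by (rule bij_betw_combine) auto
  moreover have "x ` {0..a} \<union> ({1..n} - x ` {0..a}) = {1..n}" using x by auto
  ultimately have "T \<in> tableaux (hook n a)"
    using assms(1) by (simp add: tableaux_def sum_list_hook)
  moreover have "\<forall>i\<le>a. T (i, 0) = x i" by (simp add: T_def)
  ultimately show ?thesis by blast
qed

lemma tabloid_of_hook:
  assumes "a < n" "T \<in> tableaux (hook n a)"
  shows "tabloid_of (hook n a) T = hook_tabloid n a (\<lambda>i. T (i, 0))"
proof -
  have T: "bij_betw T (diagram (hook n a)) {1..n}"
    using assms by (simp add: tableaux_def sum_list_hook)
  have "{1..n} - (\<lambda>i. T (i, 0)) ` {1..a} = T ` diagram (hook n a) - T ` ((\<lambda>i. (i, 0)) ` {1..a})"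
    using T by (simp add: bij_betw_def image_image)
  also have "\<dots> = T ` (diagram (hook n a) - (\<lambda>i. (i, 0)) ` {1..a})"
    using T assms(1)
    by (intro inj_on_image_set_diff[symmetric]) (auto simp: bij_betw_def diagram_hook)
  also have "diagram (hook n a) - (\<lambda>i. (i, 0)) ` {1..a} = (\<lambda>j. (0, j)) ` {0..<n - a}"
    using assms(1) unfolding diagram_hook[OF assms(1)] by (auto simp: image_iff)
  finally have row: "{1..n} - (\<lambda>i. T (i, 0)) ` {1..a} = {T (0, j) |j. j < n - a}"
    by (auto simp: image_iff)
  have len: "length (hook n a) = Suc a" by (simp add: hook_def)
  have nth: "hook n a ! i = 1" if "Suc 0 \<le> i" "i < Suc a" for i
    using that by (cases i) (auto simp: hook_def)
  have "map (\<lambda>i. {T (i, j) |j. j < hook n a ! i}) [1..<Suc a] = map (\<lambda>i. {T (i, 0)}) [1..<Suc a]"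
    by (intro map_cong refl) (auto simp: nth simp del: upt_Suc)
  moreover have "[0..<Suc a] = 0 # [1..<Suc a]" by (simp add: upt_conv_Cons del: upt_Suc)
  moreover have "hook n a ! 0 = n - a" by (simp add: hook_def)
  ultimately show ?thesis
    unfolding tabloid_of_def hook_tabloid_def len row by (simp only: list.map)
qed

text \<open>Every nonempty column except the first is a single cell, so a column-preserving
  permutation fixes all entries outside the first column, while the first column may be permuted
  freely.\<close>

lemma column_stabilizer_hook:
  assumes "a < n" "T \<in> tableaux (hook n a)"
  shows "column_stabilizer (hook n a) T = {p. p permutes (\<lambda>i. T (i, 0)) ` {0..a}}"
proof -
  let ?X = "(\<lambda>i. T (i, 0)) ` {0..a}"
  have T: "bij_betw T (diagram (hook n a)) {1..n}"
    using assms by (simp add: tableaux_def sum_list_hook)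
  have col: "{T (i, j) |i. (i, j) \<in> diagram (hook n a)} =
      (if j = 0 then ?X else if j < n - a then {T (0, j)} else {})" for j
    using assms(1) by (auto simp: diagram_hook image_iff)
  have sub: "?X \<subseteq> {1..n}" using column_of_tableau[OF assms] by (simp add: columns_def)
  have rest: "\<exists>j. 0 < j \<and> j < n - a \<and> y = T (0, j)" if "y \<in> {1..n}" "y \<notin> ?X" for y
  proof -
    have "y \<in> T ` diagram (hook n a)" using that(1) T by (simp add: bij_betw_def)
    then obtain c where c: "c \<in> diagram (hook n a)" "y = T c" by blast
    then have "c \<notin> (\<lambda>i. (i, 0)) ` {0..a}" using that(2) by auto
    then obtain j where "j \<in> {1..<n - a}" "c = (0, j)"
      using c(1) unfolding diagram_hook[OF assms(1)] by auto
    then show ?thesis using c(2) by (intro exI[of _ j]) simp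
  qed
  have notin: "T (0, j) \<notin> ?X" if "0 < j" "j < n - a" for j
  proof
    assume "T (0, j) \<in> ?X"
    then obtain i where "i \<le> a" "T (0, j) = T (i, 0)" by auto
    moreover have "(0, j) \<in> diagram (hook n a)" "(i, 0) \<in> diagram (hook n a)"
      using that \<open>i \<le> a\<close> assms(1) by (auto simp: diagram_hook)
    ultimately have "(0, j) = (i, 0::nat)" using T unfolding bij_betw_def inj_on_def by blast
    then show False using that by simp
  qed
  show ?thesis
  proof (intro set_eqI iffI; unfold mem_Collect_eq)
    fix p assume "p \<in> column_stabilizer (hook n a) T"
    then have p: "p permutes {1..n}"
      and st: "\<And>j. p ` (if j = 0 then ?X else if j < n - a then {T (0, j)} else {}) =
        (if j = 0 then ?X else if j < n - a then {T (0, j)} else {})"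
      using assms(1) unfolding column_stabilizer_def Let_def col by (auto simp: sum_list_hook)
    show "p permutes ?X"
      using p
    proof (rule permutes_superset)
      fix y assume "y \<in> {1..n} - ?X"
      then obtain j where "0 < j" "j < n - a" "y = T (0, j)" using rest by blast
      then show "p y = y" using st[of j] by simp
    qed
  next
    fix p assume p: "p permutes ?X"
    then have "p permutes {1..n}" using sub by (rule permutes_subset)
    moreover have "p ` {T (i, j) |i. (i, j) \<in> diagram (hook n a)} =
        {T (i, j) |i. (i, j) \<in> diagram (hook n a)}" for j
      unfolding col using permutes_image[OF p] permutes_not_in[OF p notin[of j]] by auto
    ultimately show "p \<in> column_stabilizer (hook n a) T"
      using assms(1) by (simp add: column_stabilizer_def Let_def sum_list_hook)
  qed
qed

lemma polytabloid_hook: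
  assumes "a < n" "T \<in> tableaux (hook n a)"
  shows "polytabloid (hook n a) T = column_vec n a (\<lambda>i. T (i, 0))"
  unfolding polytabloid_def column_vec_def column_stabilizer_hook[OF assms]
proof (intro sum.cong refl)
  fix p assume "p \<in> {p. p permutes (\<lambda>i. T (i, 0)) ` {0..a}}"
  then have "p permutes {1..n}"
    using column_of_tableau[OF assms] permutes_subset[of p _ "{1..n}"] by (simp add: columns_def)
  then have "p \<circ> T \<in> tableaux (hook n a)"
    using assms bij_betw_trans[of T _ "{1..n}" p "{1..n}"]
    by (simp add: tableaux_def sum_list_hook permutes_imp_bij)
  then show "Poly_Mapping.single (tabloid_of (hook n a) (p \<circ> T)) (complex_of_int (sign p)) =
      Poly_Mapping.single (hook_tabloid n a (p \<circ> (\<lambda>i. T (i, 0)))) (of_int (sign p))"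
    using tabloid_of_hook[OF assms(1)] by (simp add: o_def)
qed

lemma column_vec_cong:
  assumes "\<And>i. i \<le> a \<Longrightarrow> x i = y i"
  shows "column_vec n a x = column_vec n a y"
proof -
  have "x ` {0..a} = y ` {0..a}" using assms by (intro image_cong) auto
  moreover have "hook_tabloid n a (p \<circ> x) = hook_tabloid n a (p \<circ> y)" for p
    using assms by (simp add: hook_tabloid_eq_iff)
  ultimately show ?thesis by (simp add: column_vec_def)
qed

text \<open>The polytabloid of a tableau is determined by its first column, and any injective column
  extends to a tableau. Tableaux are therefore replaced by \<open>columns\<close> in all later
  arguments.\<close>

lemma specht_hook:
  assumes "a < n"
  shows "specht (hook n a) = tabloid_space.span (column_vec n a ` columns n a)"
proof -
  have "polytabloid (hook n a) ` tableaux (hook n a) = column_vec n a ` columns n a"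
  proof (intro equalityI subsetI)
    fix v assume "v \<in> polytabloid (hook n a) ` tableaux (hook n a)"
    then show "v \<in> column_vec n a ` columns n a"
      using polytabloid_hook[OF assms] column_of_tableau[OF assms] by auto
  next
    fix v assume "v \<in> column_vec n a ` columns n a"
    then obtain x where x: "x \<in> columns n a" "v = column_vec n a x" by auto
    then obtain T where T: "T \<in> tableaux (hook n a)" "\<forall>i\<le>a. T (i, 0) = x i"
      using tableau_of_column[OF assms] by blast
    then have "v = polytabloid (hook n a) T"
      unfolding x(2) polytabloid_hook[OF assms T(1)] by (intro column_vec_cong) simp
    then show "v \<in> polytabloid (hook n a) ` tableaux (hook n a)" using T by blast
  qed
  then show ?thesis by (simp add: specht_def)
qed

lemma subspace_specht: "tabloid_space.subspace (specht th)"
  by (simp add: specht_def)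

section \<open>Group action and linear relations in the Specht module\<close>

lemma columnsD:
  assumes "x \<in> columns n a"
  shows "inj_on x {0..a}" "x ` {0..a} \<subseteq> {1..n}"
  using assms by (auto simp: columns_def)

lemma comp_in_columns:
  assumes "x \<in> columns n a" "g permutes {1..n}"
  shows "g \<circ> x \<in> columns n a"
proof -
  have "inj_on (g \<circ> x) {0..a}"
    using columnsD[OF assms(1)] permutes_inj_on[OF assms(2)] by (intro comp_inj_on) auto
  moreover have "(g \<circ> x) ` {0..a} \<subseteq> {1..n}"
    using columnsD(2)[OF assms(1)] permutes_image[OF assms(2)] by (metis image_comp image_mono)
  ultimately show ?thesis by (simp add: columns_def)
qed

text \<open>Conjugation by \<open>g\<close> matches the permutations of a column with those of its
  image and preserves signs, so antisymmetrization is equivariant.\<close>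

lemma act_column_vec:
  assumes g: "g permutes {1..n}"
  shows "act g (column_vec n a x) = column_vec n a (g \<circ> x)"
proof -
  let ?X = "x ` {0..a}"
  have g': "bij g" using permutes_bij[OF g] .
  have inv_g: "inv g permutes {1..n}" using g by (rule permutes_inv)
  have "act g (column_vec n a x) = (\<Sum>p | p permutes ?X.
      Poly_Mapping.single (hook_tabloid n a (g \<circ> (p \<circ> x))) (of_int (sign p)))"
    by (simp add: column_vec_def act_sum map_image_hook_tabloid[OF g])
  also have "\<dots> = (\<Sum>p | p permutes g ` ?X.
      Poly_Mapping.single (hook_tabloid n a (p \<circ> (g \<circ> x))) (of_int (sign p)))"
  proof (rule sum.reindex_bij_witness[where i = "\<lambda>p. inv g \<circ> p \<circ> g" and j = "\<lambda>p. g \<circ> p \<circ> inv g"])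
    fix p assume "p \<in> {p. p permutes ?X}"
    then have p: "p permutes ?X" by simp
    show "inv g \<circ> (g \<circ> p \<circ> inv g) \<circ> g = p"
      using permutes_inverses[OF g] by (simp add: fun_eq_iff)
    show "g \<circ> p \<circ> inv g \<in> {p. p permutes g ` ?X}"
      using permutes_conj_image[OF p g'] by simp
    have "permutation p" "permutation g" using p g permutation_permutes by auto
    moreover have "g \<circ> p \<circ> inv g \<circ> (g \<circ> x) = g \<circ> (p \<circ> x)"
      using permutes_inverses[OF g] by (simp add: fun_eq_iff)
    ultimately show "Poly_Mapping.single (hook_tabloid n a (g \<circ> p \<circ> inv g \<circ> (g \<circ> x)))
        (of_int (sign (g \<circ> p \<circ> inv g))) =
      Poly_Mapping.single (hook_tabloid n a (g \<circ> (p \<circ> x))) (complex_of_int (sign p))"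
      by (simp only: sign_conj)
  next
    fix p assume "p \<in> {p. p permutes g ` ?X}"
    then have p: "p permutes g ` ?X" by simp
    show "g \<circ> (inv g \<circ> p \<circ> g) \<circ> inv g = p"
      using permutes_inverses[OF g] by (simp add: fun_eq_iff)
    have "inv g ` g ` ?X = ?X" using permutes_inverses[OF g] by (simp add: image_image)
    then show "inv g \<circ> p \<circ> g \<in> {p. p permutes ?X}"
      using permutes_conj_image[OF p permutes_bij[OF inv_g]] permutes_inv_inv[OF g] by simp
  qed
  finally show ?thesis by (simp add: column_vec_def image_comp)
qed

lemma specht_hook_induct [consumes 2, case_names zero add]:
  assumes "a < n" "v \<in> specht (hook n a)" "P 0"
    and "\<And>c x w. x \<in> columns n a \<Longrightarrow> P w \<Longrightarrow> P (scale_vec c (column_vec n a x) + w)"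
  shows "P v"
  using assms(2) unfolding specht_hook[OF assms(1)]
  by (induction rule: tabloid_space.span_induct_alt) (use assms(3,4) in auto)

lemma column_vec_in_specht:
  "a < n \<Longrightarrow> x \<in> columns n a \<Longrightarrow> column_vec n a x \<in> specht (hook n a)"
  unfolding specht_hook by (intro tabloid_space.span_base) auto

lemma act_in_specht:
  assumes "a < n" "g permutes {1..n}" "v \<in> specht (hook n a)"
  shows "act g v \<in> specht (hook n a)"
  using assms(1,3)
proof (induction rule: specht_hook_induct)
  case zero
  then show ?case
    using module_hom.zero[OF module_hom_act] tabloid_space.subspace_0[OF subspace_specht] by simp
next
  case (add c x w)
  have "act g (column_vec n a x) \<in> specht (hook n a)"
    using assms(1,2) add by (simp add: act_column_vec column_vec_in_specht comp_in_columns)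
  with add show ?case
    by (simp add: act_add act_scale tabloid_space.subspace_add[OF subspace_specht]
        tabloid_space.subspace_scale[OF subspace_specht])
qed

lemma lookup_column_vec:
  "Poly_Mapping.lookup (column_vec n a x) (hook_tabloid n a y) =
    (\<Sum>p | p permutes x ` {0..a}. of_int (sign p) * of_bool (\<forall>i\<in>{1..a}. p (x i) = y i))"
  unfolding column_vec_def lookup_sum
  by (intro sum.cong refl) (simp add: lookup_single hook_tabloid_eq_iff when_def)

text \<open>This rules out tabloids with repeated entries when a vector is shown to vanish
  coefficientwise.\<close>

lemma specht_hook_support:
  assumes "a < n" "v \<in> specht (hook n a)" "Poly_Mapping.lookup v k \<noteq> 0"
  shows "\<exists>y\<in>columns n a. k = hook_tabloid n a y"
  using assms
proof (induction rule: specht_hook_induct)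
  case zero
  then show ?case by simp
next
  case (add c x w)
  show ?case
  proof (cases "Poly_Mapping.lookup w k = 0")
    case True
    then have "Poly_Mapping.lookup (column_vec n a x) k \<noteq> 0" using add by (auto simp: lookup_add)
    then have "\<exists>p. p permutes x ` {0..a} \<and> k = hook_tabloid n a (p \<circ> x)"
      unfolding column_vec_def lookup_sum
      by (metis (mono_tags, lifting) lookup_single_not_eq mem_Collect_eq sum.not_neutral_contains_not_neutral)
    then obtain p where p: "p permutes x ` {0..a}" "k = hook_tabloid n a (p \<circ> x)" by blast
    then show ?thesis
      using comp_in_columns[OF add(1)] permutes_subset[OF p(1) columnsD(2)[OF add(1)]] by blast
  qed (use add in auto)
qed

text \<open>If the entries of \<open>y\<close> below the corner lie in the column \<open>x\<close>,
  then \<open>q\<close> is itself a column permutation, and substituting \<open>q \<circ> p\<close>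
  for \<open>p\<close> produces the sign. Otherwise no term contributes on either side.\<close>

lemma specht_hook_alternating:
  assumes "a < n" "v \<in> specht (hook n a)" "q permutes y ` {1..a}"
  shows "Poly_Mapping.lookup v (hook_tabloid n a (q \<circ> y)) =
    of_int (sign q) * Poly_Mapping.lookup v (hook_tabloid n a y)"
  using assms(1,2)
proof (induction rule: specht_hook_induct)
  case zero
  then show ?case by simp
next
  case (add c x w)
  let ?X = "x ` {0..a}"
  have "Poly_Mapping.lookup (column_vec n a x) (hook_tabloid n a (q \<circ> y)) =
    of_int (sign q) * Poly_Mapping.lookup (column_vec n a x) (hook_tabloid n a y)"
  proof (cases "y ` {1..a} \<subseteq> ?X")
    case True
    then have q: "q permutes ?X" using assms(3) permutes_subset by blast
    have "Poly_Mapping.lookup (column_vec n a x) (hook_tabloid n a (q \<circ> y)) =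
      (\<Sum>p | p permutes ?X. of_int (sign (q \<circ> p)) * of_bool (\<forall>i\<in>{1..a}. (q \<circ> p) (x i) = q (y i)))"
      unfolding lookup_column_vec o_apply[of q y] by (rule setum_permutations_compose_left[OF q])
    also have "\<dots> = (\<Sum>p | p permutes ?X. of_int (sign q) *
        (of_int (sign p) * of_bool (\<forall>i\<in>{1..a}. p (x i) = y i)))"
      using q by (intro sum.cong refl)
        (simp add: sign_compose_permutes[of ?X] inj_eq[OF permutes_inj[OF q]])
    finally show ?thesis by (simp add: lookup_column_vec sum_distrib_left)
  next
    case False
    have no: "\<not> (\<forall>i\<in>{1..a}. p (x i) = y i)"
      if "p permutes ?X" "\<not> y ` {1..a} \<subseteq> ?X" for p and y :: "nat \<Rightarrow> nat"
    proof
      assume *: "\<forall>i\<in>{1..a}. p (x i) = y i"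
      have "y i \<in> ?X" if "i \<in> {1..a}" for i
      proof -
        have "p (x i) \<in> ?X" using that permutes_in_image[OF \<open>p permutes ?X\<close>] by auto
        then show ?thesis using * that by simp
      qed
      then show False using \<open>\<not> y ` {1..a} \<subseteq> ?X\<close> by blast
    qed
    have "\<not> (q \<circ> y) ` {1..a} \<subseteq> ?X"
      using False permutes_image[OF assms(3)] unfolding image_comp[symmetric] by simp
    moreover have "Poly_Mapping.lookup (column_vec n a x) (hook_tabloid n a y) = 0"
      if "\<not> y ` {1..a} \<subseteq> ?X" for y
      unfolding lookup_column_vec by (rule sum.neutral) (use no[OF _ that] in simp)
    ultimately show ?thesis using False by simp
  qed
  then show ?case using add(2) by (simp add: lookup_add algebra_simps del: o_apply)
qed

text \<open>The Garnir relation of a row-column pair: it makes the tabloids that avoid the entry 1 below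
  the corner sufficient to determine a vector of the Specht module.\<close>

lemma specht_hook_garnir:
  assumes "a < n" "v \<in> specht (hook n a)" "i \<in> {1..a}"
  shows "(\<Sum>z\<in>{1..n} - y ` ({1..a} - {i}). Poly_Mapping.lookup v (hook_tabloid n a (y(i := z)))) = 0"
  using assms(1,2)
proof (induction rule: specht_hook_induct)
  case zero
  then show ?case by simp
next
  case (add c x w)
  let ?X = "x ` {0..a}" and ?Z = "{1..n} - y ` ({1..a} - {i})"
  \<comment> \<open>\<open>F\<close> drops the condition at \<open>i\<close>. For given
    \<open>p\<close> only \<open>z = p (x i)\<close> can meet that condition, and injectivity puts
    this \<open>z\<close> into the range of summation whenever \<open>F p\<close> is 1.\<close>
  define F where "F p = (of_bool (\<forall>k\<in>{1..a} - {i}. p (x k) = y k) :: complex)" for p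
  note x = columnsD[OF add(1)]
  have inj: "x k = x l \<longleftrightarrow> k = l" if "k \<le> a" "l \<le> a" for k l
    using inj_on_eq_iff[OF x(1)] that by simp
  have "(\<Sum>z\<in>?Z. Poly_Mapping.lookup (column_vec n a x) (hook_tabloid n a (y(i := z)))) =
    (\<Sum>p | p permutes ?X. of_int (sign p) *
      (\<Sum>z\<in>?Z. of_bool (\<forall>k\<in>{1..a}. p (x k) = (y(i := z)) k)))"
    unfolding lookup_column_vec by (subst sum.swap) (simp only: sum_distrib_left)
  also have "\<dots> = (\<Sum>p | p permutes ?X. of_int (sign p) * F p)"
  proof (intro sum.cong refl)
    fix p assume "p \<in> {p. p permutes ?X}"
    then have p: "p permutes ?X" by simp
    have "(\<Sum>z\<in>?Z. of_bool (\<forall>k\<in>{1..a}. p (x k) = (y(i := z)) k) :: complex) =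
        (\<Sum>z\<in>?Z. if z = p (x i) then F p else 0)"
      by (intro sum.cong refl) (use assms(3) in \<open>auto simp: F_def\<close>)
    also have "\<dots> = F p"
    proof -
      have "p (x i) \<in> ?X" using assms(3) permutes_in_image[OF p] by auto
      then have "p (x i) \<in> {1..n}" using x(2) by blast
      moreover have "p (x i) \<notin> y ` ({1..a} - {i})" if *: "\<forall>k\<in>{1..a} - {i}. p (x k) = y k"
      proof
        assume "p (x i) \<in> y ` ({1..a} - {i})"
        then obtain k where k: "k \<in> {1..a} - {i}" "p (x i) = y k" by blast
        then have "p (x i) = p (x k)" using * by simp
        then show False using inj[of i k] injD[OF permutes_inj[OF p]] assms(3) k(1) by auto
      qed
      ultimately show ?thesis by (auto simp: F_def)
    qed
    finally show "of_int (sign p) *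
        (\<Sum>z\<in>?Z. of_bool (\<forall>k\<in>{1..a}. p (x k) = (y(i := z)) k)) = of_int (sign p) * F p" by simp
  qed
  also have "\<dots> = 0"
  \<comment> \<open>\<open>F\<close> ignores the values of \<open>p\<close> at \<open>x 0\<close>
    and \<open>x i\<close>, so swapping these two entries pairs terms of opposite sign.\<close>
  proof (rule sum_sign_eq_0[where u = "x 0" and v = "x i"])
    fix p
    have "x k \<noteq> x 0" "x k \<noteq> x i" if "k \<in> {1..a} - {i}" for k
      using that assms(3) by (auto simp: inj)
    then show "F (p \<circ> transpose (x 0) (x i)) = F p" by (simp add: F_def)
  qed (use assms(3) inj[of 0 i] in auto)
  finally show ?case
    using add(2) by (simp add: lookup_add sum.distrib del: fun_upd_apply flip: sum_distrib_left)
qed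

section \<open>The hook characters\<close>

text \<open>For each possible set of entries below a corner entry 1, one first column is chosen.\<close>

definition corner_column :: "nat set \<Rightarrow> nat \<Rightarrow> nat" where
  "corner_column Y = (SOME x. x 0 = 1 \<and> bij_betw x {1..card Y} Y)"

definition legs :: "nat \<Rightarrow> nat \<Rightarrow> nat set set" where
  "legs n a = {Y. Y \<subseteq> {2..n} \<and> card Y = a}"

lemma finite_legs: "finite (legs n a)"
  unfolding legs_def by (rule finite_subset[of _ "Pow {2..n}"]) auto

lemma finite_leg: "Y \<in> legs n a \<Longrightarrow> finite Y"
  unfolding legs_def using finite_subset[of Y "{2..n}"] by simp

lemma corner_column:
  assumes "a < n" "Y \<in> legs n a"
  shows "corner_column Y \<in> columns n a" "corner_column Y ` {1..a} = Y"
    "corner_column Y ` {0..a} = insert 1 Y"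
proof -
  let ?x = "corner_column Y"
  have Y: "Y \<subseteq> {2..n}" "card Y = a" using assms(2) by (auto simp: legs_def)
  then have "finite Y" using finite_subset by blast
  then obtain h where h: "bij_betw h {1..a} Y"
    using finite_same_card_bij[of "{1..a}" Y] Y by auto
  \<comment> \<open>Index 0 lies outside \<open>{1..a}\<close>, so the corner can be set to 1
    without disturbing the bijection. This is the witness for the choice in
    \<open>corner_column\<close>.\<close>
  then have "bij_betw (h(0 := 1)) {1..a} Y"
    using bij_betw_cong[of "{1..a}" "h(0 := 1)" h Y] by simp
  then have "(h(0 := 1)) 0 = 1 \<and> bij_betw (h(0 := 1)) {1..card Y} Y" using Y(2) by simp
  then have "?x 0 = 1 \<and> bij_betw ?x {1..card Y} Y"
    unfolding corner_column_def
    by (rule someI[of "\<lambda>x. x 0 = 1 \<and> bij_betw x {1..card Y} Y"])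
  then have x: "?x 0 = 1" "bij_betw ?x {1..a} Y" using Y(2) by auto
  show im: "?x ` {1..a} = Y" using x(2) by (simp add: bij_betw_def)
  have "{0..a} = insert 0 {1..a}" by auto
  then show im0: "?x ` {0..a} = insert 1 Y" using x(1) im by simp
  have "inj_on ?x (insert 0 {1..a})"
    using x Y(1) by (auto simp: bij_betw_def)
  moreover have "insert 1 Y \<subseteq> {1..n}" using Y(1) assms(1) by fastforce
  ultimately show "?x \<in> columns n a"
    unfolding columns_def mem_Collect_eq im0 \<open>{0..a} = _\<close>[symmetric] by blast
qed

text \<open>A column permutation that carries the leg \<open>Y\<close> to a leg \<open>Y'\<close>
  without 1 cannot bring 1 below the corner, so \<open>Y'\<close> lies in \<open>Y\<close> and
  equals it by size. The entries below the corner are then fixed one by one, which leaves only the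
  identity.\<close>

lemma lookup_corner_column:
  assumes "a < n" "Y \<in> legs n a" "Y' \<in> legs n a"
  shows "Poly_Mapping.lookup (column_vec n a (corner_column Y))
    (hook_tabloid n a (corner_column Y')) = of_bool (Y = Y')"
proof -
  let ?x = "corner_column Y" and ?x' = "corner_column Y'"
  note c = corner_column[OF assms(1,2)] and c' = corner_column[OF assms(1,3)]
  have fin: "finite Y" by (rule finite_leg[OF assms(2)])
  have card: "card Y = card Y'" and one: "1 \<notin> Y'"
    using assms(2,3) by (auto simp: legs_def)
  have iff: "(\<forall>i\<in>{1..a}. p (?x i) = ?x' i) \<longleftrightarrow> Y = Y' \<and> p = id" if p: "p permutes insert 1 Y" for p
  proof
    assume *: "\<forall>i\<in>{1..a}. p (?x i) = ?x' i"
    then have "(\<lambda>i. p (?x i)) ` {1..a} = ?x' ` {1..a}" by (intro image_cong) blast+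
    then have "p ` ?x ` {1..a} = ?x' ` {1..a}" by (simp only: image_image)
    then have "p ` Y = Y'" unfolding c(2) c'(2) .
    moreover have "p ` Y \<subseteq> insert 1 Y" using permutes_in_image[OF p] by auto
    ultimately have "Y' \<subseteq> insert 1 Y" by simp
    then have "Y' \<subseteq> Y" using one by (simp add: subset_insert)
    then have eq: "Y = Y'" using card_subset_eq[OF fin, of Y'] card by simp
    have "p = id"
    proof (rule permutes_insert_eqI[OF p])
      fix y assume "y \<in> Y"
      then have "y \<in> ?x ` {1..a}" unfolding c(2) .
      then show "p y = id y" using * unfolding eq by auto
    qed (rule permutes_id)
    with eq show "Y = Y' \<and> p = id" ..
  qed simp
  have "Poly_Mapping.lookup (column_vec n a ?x) (hook_tabloid n a ?x') =
      (\<Sum>p | p permutes insert 1 Y. if p = id then of_bool (Y = Y') else 0)"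
    unfolding lookup_column_vec c(3)
  proof (intro sum.cong refl)
    fix p assume "p \<in> {p. p permutes insert 1 Y}"
    then show "of_int (sign p) * of_bool (\<forall>i\<in>{1..a}. p (?x i) = ?x' i) =
        (if p = id then of_bool (Y = Y') else 0 :: complex)"
      using iff[of p] by (simp only: mem_Collect_eq) (cases "p = id"; simp)
  qed
  moreover have "finite {p. p permutes insert 1 Y}" using fin by (intro finite_permutations) simp
  ultimately show ?thesis by (simp only: sum.delta mem_Collect_eq permutes_id if_True)
qed

text \<open>Coefficients at tabloids of injective columns without 1 below the corner are signed
  copies of the given zeros, by alternation. If 1 does occur there, the Garnir relation at its
  position expresses the coefficient through tabloids of the first kind.\<close>

lemma specht_hook_eq_0:
  assumes n: "a < n" and v: "v \<in> specht (hook n a)"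
    and zero: "\<And>Y. Y \<in> legs n a \<Longrightarrow> Poly_Mapping.lookup v (hook_tabloid n a (corner_column Y)) = 0"
  shows "v = 0"
proof (rule poly_mapping_eqI)
  have *: "Poly_Mapping.lookup v (hook_tabloid n a y) = 0"
    if y: "inj_on y {1..a}" "y ` {1..a} \<subseteq> {2..n}" for y
  proof -
    let ?Y = "y ` {1..a}"
    have Y: "?Y \<in> legs n a" using y by (simp add: legs_def card_image)
    note c = corner_column[OF n Y]
    let ?x = "corner_column ?Y"
    have inj: "inj_on ?x {1..a}" using columnsD(1)[OF c(1)] by (rule inj_on_subset) auto
    obtain q where q: "q permutes ?Y" "\<And>i. i \<in> {1..a} \<Longrightarrow> q (?x i) = y i"
      using permutes_mapping[of ?Y ?x "{1..a}" y] inj y(1) c(2) by auto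
    then have "hook_tabloid n a (q \<circ> ?x) = hook_tabloid n a y"
      by (simp add: hook_tabloid_eq_iff)
    moreover have "q permutes ?x ` {1..a}" unfolding c(2) by (rule q(1))
    ultimately show ?thesis
      using specht_hook_alternating[OF n v, of q ?x] zero[OF Y] by simp
  qed
  fix k
  show "Poly_Mapping.lookup v k = Poly_Mapping.lookup 0 k"
  proof (cases "Poly_Mapping.lookup v k = 0")
    case False
    then obtain y where y: "y \<in> columns n a" and k: "k = hook_tabloid n a y"
      using specht_hook_support[OF n v] by blast
    have y': "inj_on y {1..a}" "y ` {1..a} \<subseteq> {1..n}"
      using columnsD(2)[OF y] inj_on_subset[OF columnsD(1)[OF y], of "{1..a}"] by auto
    have "1 \<in> y ` {1..a}"
    proof (rule ccontr)
      assume "1 \<notin> y ` {1..a}"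
      have "y ` {1..a} \<subseteq> {2..n}"
      proof
        fix z assume "z \<in> y ` {1..a}"
        then have "z \<in> {1..n}" "z \<noteq> 1" using y'(2) \<open>1 \<notin> _\<close> by blast+
        then show "z \<in> {2..n}" by auto
      qed
      then show False using *[OF y'(1)] False k by simp
    qed
    then obtain i where i: "i \<in> {1..a}" "y i = 1" by auto
    let ?Z = "{1..n} - y ` ({1..a} - {i})"
    \<comment> \<open>Replacing the 1 by another admissible \<open>z\<close> gives an injective leg
      that avoids 1, so only the term \<open>z = 1\<close> of the Garnir sum can survive.\<close>
    have "Poly_Mapping.lookup v (hook_tabloid n a (y(i := z))) = 0" if z: "z \<in> ?Z - {1}" for z
    proof (rule *)
      show "inj_on (y(i := z)) {1..a}"
      proof (rule inj_onI)
        have zne: "y l \<noteq> z" if "l \<in> {1..a}" "l \<noteq> i" for l using z that by blast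
        fix j k assume jk: "j \<in> {1..a}" "k \<in> {1..a}" "(y(i := z)) j = (y(i := z)) k"
        then show "j = k"
          using inj_onD[OF y'(1) _ jk(1,2)] zne[OF jk(1)] zne[OF jk(2)]
          by (cases "j = i"; cases "k = i") simp_all
      qed
      have "y j \<noteq> 1" if "j \<in> {1..a}" "j \<noteq> i" for j
        using inj_onD[OF y'(1), of i j] i that by auto
      moreover have "y j \<in> {1..n}" if "j \<in> {1..a}" for j
        using that y'(2) by blast
      ultimately have "(y(i := z)) j \<in> {1..n} - {1}" if "j \<in> {1..a}" for j
        using that z by auto
      moreover have "{1..n} - {1} = {2..n}" by auto
      ultimately show "(y(i := z)) ` {1..a} \<subseteq> {2..n}" by (intro image_subsetI) metis
    qed
    moreover have "1 \<in> ?Z"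
    proof -
      have "1 \<notin> y ` ({1..a} - {i})"
      proof
        assume "1 \<in> y ` ({1..a} - {i})"
        then obtain j where "j \<in> {1..a} - {i}" "y j = 1" by (metis imageE)
        then show False using inj_onD[OF y'(1), of i j] i by simp
      qed
      then show ?thesis using n by simp
    qed
    ultimately have "(\<Sum>z\<in>?Z. Poly_Mapping.lookup v (hook_tabloid n a (y(i := z)))) =
        Poly_Mapping.lookup v (hook_tabloid n a (y(i := 1)))"
      by (subst sum.remove[of _ 1]) (auto intro: sum.neutral)
    then have "Poly_Mapping.lookup v (hook_tabloid n a (y(i := 1))) = 0"
      using specht_hook_garnir[OF n v i(1), of y] by simp
    moreover have "y(i := 1) = y" using i(2) by auto
    ultimately show ?thesis using k by simp
  qed simp
qed

text \<open>By the duality in \<open>lookup_corner_column\<close> the difference of the two sides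
  has coefficient 0 at every corner tabloid, and such a vector vanishes.\<close>

lemma specht_hook_frame:
  assumes n: "a < n" and v: "v \<in> specht (hook n a)"
  shows "v = (\<Sum>Y\<in>legs n a. scale_vec
    (Poly_Mapping.lookup v (hook_tabloid n a (corner_column Y))) (column_vec n a (corner_column Y)))"
    (is "v = ?w")
proof -
  note sub = subspace_specht[of "hook n a"]
  have "?w \<in> specht (hook n a)"
    using n by (intro tabloid_space.subspace_sum[OF sub] tabloid_space.subspace_scale[OF sub]
        column_vec_in_specht corner_column)
  then have "v - ?w \<in> specht (hook n a)" using v by (rule tabloid_space.subspace_diff[OF sub, rotated])
  then have "v - ?w = 0"
  proof (rule specht_hook_eq_0[OF n])
    fix Y assume Y: "Y \<in> legs n a"
    let ?c = "\<lambda>Y. Poly_Mapping.lookup v (hook_tabloid n a (corner_column Y))"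
    have "Poly_Mapping.lookup ?w (hook_tabloid n a (corner_column Y)) =
        (\<Sum>Y'\<in>legs n a. if Y' = Y then ?c Y' else 0)"
      unfolding lookup_sum by (intro sum.cong refl) (simp add: lookup_corner_column[OF n _ Y])
    then show "Poly_Mapping.lookup (v - ?w) (hook_tabloid n a (corner_column Y)) = 0"
      using Y finite_legs by (simp add: lookup_minus)
  qed
  then show ?thesis by simp
qed

lemma trace_on_specht_hook:
  assumes "a < n" "module_hom scale_vec scale_vec f"
    and "\<And>v. v \<in> specht (hook n a) \<Longrightarrow> f v \<in> specht (hook n a)"
  shows "trace_on (specht (hook n a)) f = (\<Sum>Y\<in>legs n a. Poly_Mapping.lookup
    (f (column_vec n a (corner_column Y))) (hook_tabloid n a (corner_column Y)))"
proof (rule trace_on_frame[OF subspace_specht assms(2,3) finite_legs,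
      where w = "\<lambda>Y. column_vec n a (corner_column Y)"
        and phi = "\<lambda>Y v. Poly_Mapping.lookup v (hook_tabloid n a (corner_column Y))"])
  show "column_vec n a (corner_column Y) \<in> specht (hook n a)" if "Y \<in> legs n a" for Y
    using column_vec_in_specht[OF assms(1) corner_column(1)[OF assms(1) that]] .
qed (simp_all add: module_hom_lookup specht_hook_frame[OF assms(1), symmetric])

text \<open>The diagonal entry at \<open>Y\<close> is the coefficient of the tabloid of
  \<open>Y\<close> in the translate of its own polytabloid. A term \<open>p\<close> reaches that
  tabloid exactly when \<open>g \<circ> p\<close> fixes every entry of the leg.\<close>

lemma specht_character_hook:
  assumes n: "a < n" and g: "g permutes {1..n}"
  shows "specht_character (hook n a) g =
    (\<Sum>Y\<in>legs n a. \<Sum>p | p permutes insert 1 Y \<and> (\<forall>y\<in>Y. g (p y) = y). of_int (sign p))"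
proof -
  have "specht_character (hook n a) g = (\<Sum>Y\<in>legs n a. Poly_Mapping.lookup
      (act g (column_vec n a (corner_column Y))) (hook_tabloid n a (corner_column Y)))"
    unfolding specht_character_def
    by (rule trace_on_specht_hook[OF n module_hom_act act_in_specht[OF n g]])
  also have "\<dots> = (\<Sum>Y\<in>legs n a. \<Sum>p | p permutes insert 1 Y \<and> (\<forall>y\<in>Y. g (p y) = y). of_int (sign p))"
  proof (intro sum.cong refl)
    fix Y assume Y: "Y \<in> legs n a"
    note c = corner_column[OF n Y]
    let ?x = "corner_column Y"
    have inv: "hook_tabloid n a ?x = map (image g) (hook_tabloid n a (inv g \<circ> ?x))"
      unfolding map_image_hook_tabloid[OF g] o_assoc permutes_inv_o[OF g] by simp
    have "Poly_Mapping.lookup (act g (column_vec n a ?x)) (hook_tabloid n a ?x) =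
        (\<Sum>p | p permutes insert 1 Y. of_int (sign p) * of_bool (\<forall>i\<in>{1..a}. g (p (?x i)) = ?x i))"
      unfolding column_vec_def act_sum lookup_sum act_single map_image_hook_tabloid[OF g] c(3)
      by (intro sum.cong refl) (simp add: lookup_single hook_tabloid_eq_iff when_def)
    also have "\<dots> = (\<Sum>p | p permutes insert 1 Y. if \<forall>y\<in>Y. g (p y) = y then of_int (sign p) else 0)"
    proof -
      have "(\<forall>y\<in>?x ` {1..a}. P y) = (\<forall>i\<in>{1..a}. P (?x i))" for P by blast
      then have "(\<forall>y\<in>Y. P y) = (\<forall>i\<in>{1..a}. P (?x i))" for P
        unfolding c(2) .
      then show ?thesis by (intro sum.cong refl) simp
    qed
    also have "\<dots> = (\<Sum>p | p permutes insert 1 Y \<and> (\<forall>y\<in>Y. g (p y) = y). of_int (sign p))"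
    proof -
      have "finite Y" using Y by (rule finite_leg)
      then show ?thesis by (simp add: sum.If_cases finite_permutations Collect_conj_eq)
    qed
    finally show "Poly_Mapping.lookup (act g (column_vec n a ?x)) (hook_tabloid n a ?x) =
        (\<Sum>p | p permutes insert 1 Y \<and> (\<forall>y\<in>Y. g (p y) = y). of_int (sign p))" .
  qed
  finally show ?thesis .
qed

text \<open>Moving the frame by \<open>h\<close> and pulling the coordinates back by
  \<open>inv h\<close> gives another frame, in which the conjugate has the diagonal entries of
  \<open>g\<close>. Hence \<open>irr_char\<close> of a hook can be evaluated at any
  representative.\<close>

lemma specht_character_hook_conj:
  assumes n: "a < n" and g: "g permutes {1..n}" and h: "h permutes {1..n}"
  shows "specht_character (hook n a) (h \<circ> g \<circ> inv h) = specht_character (hook n a) g"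
proof -
  let ?V = "specht (hook n a)" and ?e = "\<lambda>Y. column_vec n a (corner_column Y)"
    and ?k = "\<lambda>Y. hook_tabloid n a (corner_column Y)"
  have h': "inv h permutes {1..n}" and hgh: "h \<circ> g \<circ> inv h permutes {1..n}"
    using g h by (auto intro!: permutes_compose permutes_inv)
  have id: "act h (act (inv h) v) = v" for v
    by (simp only: act_act permutes_inv_o[OF h] act_id)
  have e: "?e Y \<in> ?V" if "Y \<in> legs n a" for Y
    using column_vec_in_specht[OF n] corner_column(1)[OF n that] by blast
  have "trace_on ?V (act (h \<circ> g \<circ> inv h)) = (\<Sum>Y\<in>legs n a. Poly_Mapping.lookup
      (act (inv h) (act (h \<circ> g \<circ> inv h) (act h (?e Y)))) (?k Y))"
  proof (rule trace_on_frame[OF subspace_specht module_hom_act _ finite_legs,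
        where w = "\<lambda>Y. act h (?e Y)"
          and phi = "\<lambda>Y v. Poly_Mapping.lookup (act (inv h) v) (?k Y)"])
    show "act (h \<circ> g \<circ> inv h) v \<in> ?V" if "v \<in> ?V" for v
      using act_in_specht[OF n hgh that] .
    show "act h (?e Y) \<in> ?V" if "Y \<in> legs n a" for Y
      using act_in_specht[OF n h e[OF that]] .
    show "module_hom scale_vec (*) (\<lambda>v. Poly_Mapping.lookup (act (inv h) v) (?k Y))" for Y
      using module_hom_compose[OF module_hom_act module_hom_lookup] by (simp add: o_def)
    fix v assume "v \<in> ?V"
    then have "act (inv h) v \<in> ?V" by (rule act_in_specht[OF n h'])
    then have "act h (act (inv h) v) = act h (\<Sum>Y\<in>legs n a.
        scale_vec (Poly_Mapping.lookup (act (inv h) v) (?k Y)) (?e Y))"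
      by (intro arg_cong[of _ _ "act h"] specht_hook_frame[OF n])
    then show "v = (\<Sum>Y\<in>legs n a.
        scale_vec (Poly_Mapping.lookup (act (inv h) v) (?k Y)) (act h (?e Y)))"
      unfolding id by (simp add: act_sum act_scale)
  qed
  also have "\<dots> = (\<Sum>Y\<in>legs n a. Poly_Mapping.lookup (act g (?e Y)) (?k Y))"
  proof -
    have "inv h \<circ> (h \<circ> g \<circ> inv h \<circ> h) = g"
      using permutes_inverses[OF h] by (simp add: fun_eq_iff)
    then show ?thesis by (simp add: act_act)
  qed
  also have "\<dots> = trace_on ?V (act g)"
    by (rule trace_on_specht_hook[OF n module_hom_act act_in_specht[OF n g], symmetric])
  finally show ?thesis by (simp add: specht_character_def)
qed

section \<open>The action of the central element\<close>

lemma columns_image_eq: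
  "x ` {0..a} = insert (x 0) (x ` {1..a})" for x :: "nat \<Rightarrow> 'a"
proof -
  have "{0..a} = insert 0 {1..a}" by auto
  then show ?thesis by simp
qed

lemma column_permutation_unique:
  fixes x :: "nat \<Rightarrow> 'a"
  assumes "p permutes x ` {0..a}" "q permutes x ` {0..a}" "\<And>i. i \<in> {1..a} \<Longrightarrow> p (x i) = q (x i)"
  shows "p = q"
  using assms(1,2) unfolding columns_image_eq
  by (rule permutes_insert_eqI) (use assms(3) in blast)

text \<open>The hook case of James's submodule lemma.\<close>

lemma signed_column_sum:
  assumes x: "x \<in> columns n a" and y: "y \<in> columns n a"
  shows "(\<Sum>p | p permutes x ` {0..a}.
      Poly_Mapping.single (hook_tabloid n a (p \<circ> y)) (of_int (sign p))) =
    scale_vec (Poly_Mapping.lookup (column_vec n a x) (hook_tabloid n a y)) (column_vec n a x)"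
    (is "?L = ?R")
proof -
  let ?X = "x ` {0..a}"
  have fin: "finite ?X" by simp
  show ?thesis
  \<comment> \<open>If a column permutation \<open>q\<close> carries the leg of \<open>x\<close> to
    that of \<open>y\<close>, it is unique, and right multiplication by it turns one side into the
    other with the factor \<open>sign q\<close>. Otherwise both sides vanish.\<close>
  proof (cases "\<exists>q. q permutes ?X \<and> (\<forall>i\<in>{1..a}. q (x i) = y i)")
    case True
    then obtain q where q: "q permutes ?X" "\<And>i. i \<in> {1..a} \<Longrightarrow> q (x i) = y i" by blast
    have "Poly_Mapping.lookup (column_vec n a x) (hook_tabloid n a y) =
        (\<Sum>p | p permutes ?X. if p = q then of_int (sign p) else 0)"
      unfolding lookup_column_vec
    proof (intro sum.cong refl)
      fix p assume "p \<in> {p. p permutes ?X}"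
      then have "(\<forall>i\<in>{1..a}. p (x i) = y i) \<longleftrightarrow> p = q"
        using column_permutation_unique[of p x a q] q by auto
      then show "of_int (sign p) * of_bool (\<forall>i\<in>{1..a}. p (x i) = y i) =
          (if p = q then of_int (sign p) else 0 :: complex)" by simp
    qed
    also have "\<dots> = of_int (sign q)" using q(1) finite_permutations[OF fin] by simp
    finally have "?R = (\<Sum>p | p permutes ?X.
        Poly_Mapping.single (hook_tabloid n a (p \<circ> x)) (of_int (sign q * sign p)))"
      by (simp add: column_vec_def tabloid_space.scale_sum_right)
    also have "\<dots> = (\<Sum>p | p permutes ?X.
        Poly_Mapping.single (hook_tabloid n a (p \<circ> q \<circ> x)) (of_int (sign q * sign (p \<circ> q))))"
      by (rule sum_permutations_compose_right[OF q(1)])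
    also have "\<dots> = ?L"
    proof (intro sum.cong refl)
      fix p assume "p \<in> {p. p permutes ?X}"
      then have "sign q * sign (p \<circ> q) = sign p"
        using sign_compose_permutes[OF fin _ q(1)] by simp
      moreover have "hook_tabloid n a (p \<circ> q \<circ> x) = hook_tabloid n a (p \<circ> y)"
        using q(2) by (simp add: hook_tabloid_eq_iff)
      ultimately show "Poly_Mapping.single (hook_tabloid n a (p \<circ> q \<circ> x))
          (of_int (sign q * sign (p \<circ> q))) =
        Poly_Mapping.single (hook_tabloid n a (p \<circ> y)) (complex_of_int (sign p))" by simp
    qed
    finally show ?thesis ..
  next
    case False
    have inj: "inj_on x {1..a}" "inj_on y {1..a}"
      using columnsD(1)[OF x] columnsD(1)[OF y] inj_on_subset[of _ "{0..a}" "{1..a}"] by auto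
    have "\<not> y ` {1..a} \<subseteq> ?X"
    proof
      assume "y ` {1..a} \<subseteq> ?X"
      moreover have "x ` {1..a} \<subseteq> ?X" by auto
      ultimately show False
        using permutes_mapping[OF fin inj] False by metis
    qed
    then have "card (?X \<inter> y ` {1..a}) < card (y ` {1..a})"
      by (intro psubset_card_mono) auto
    then have "card (?X \<inter> y ` {1..a}) < a" using inj(2) by (simp add: card_image)
    moreover have "card ?X = Suc a" using columnsD(1)[OF x] by (simp add: card_image)
    \<comment> \<open>The column has \<open>a + 1\<close> entries and fewer than \<open>a\<close> of
      them occur below the corner of \<open>y\<close>, so two entries \<open>u\<close> and
      \<open>v\<close> are left over. Swapping them before applying \<open>p\<close> keeps the
      tabloid and flips the sign.\<close>
    ultimately have "\<not> card (?X - y ` {1..a}) \<le> Suc 0"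
      using card_Diff_subset_Int[of ?X "y ` {1..a}"] by simp
    then obtain u v where uv: "u \<in> ?X - y ` {1..a}" "v \<in> ?X - y ` {1..a}" "u \<noteq> v"
      using card_le_Suc0_iff_eq[of "?X - y ` {1..a}"] by auto
    have "?L = 0"
    proof (rule poly_mapping_eqI)
      fix k
      have "Poly_Mapping.lookup ?L k =
          (\<Sum>p | p permutes ?X. of_int (sign p) * of_bool (hook_tabloid n a (p \<circ> y) = k))"
        unfolding lookup_sum by (intro sum.cong refl) (simp add: lookup_single when_def)
      also have "\<dots> = 0"
      proof (rule sum_sign_eq_0[OF fin _ _ uv(3)])
        fix p
        have "hook_tabloid n a (p \<circ> transpose u v \<circ> y) = hook_tabloid n a (p \<circ> y)"
          unfolding hook_tabloid_eq_iff
        proof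
          fix i assume "i \<in> {1..a}"
          then have "y i \<in> y ` {1..a}" by (rule imageI)
          then have "y i \<noteq> u" "y i \<noteq> v" using uv by blast+
          then show "(p \<circ> transpose u v \<circ> y) i = (p \<circ> y) i" by simp
        qed
        then show "of_bool (hook_tabloid n a (p \<circ> transpose u v \<circ> y) = k) =
            (of_bool (hook_tabloid n a (p \<circ> y) = k) :: complex)" by simp
      qed (use uv in auto)
      finally show "Poly_Mapping.lookup ?L k = Poly_Mapping.lookup 0 k" by simp
    qed
    moreover have "Poly_Mapping.lookup (column_vec n a x) (hook_tabloid n a y) = 0"
      unfolding lookup_column_vec using False by (intro sum.neutral) auto
    ultimately show ?thesis by simp
  qed
qed

text \<open>The falling factorial belongs to the column of \<open>a + 1\<close> cells, the rising
  one to the row of \<open>n - a\<close> cells. The corner is counted in both, so for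
  \<open>a < n\<close> this is \<open>t\<close> times the product of \<open>t + c\<close> over the
  contents \<open>c\<close> of the hook.\<close>

definition content_poly :: "nat \<Rightarrow> nat \<Rightarrow> complex \<Rightarrow> complex" where
  "content_poly n a t = (\<Prod>j<Suc a. t - of_nat j) * (\<Prod>j<n - a. t + of_nat j)"

lemma content_poly_eq_H_fun:
  assumes "a < n"
  shows "content_poly n a t = t * H_fun n a t"
proof -
  have "(\<Prod>j<Suc a. t - of_nat j) = t * (\<Prod>j<a. t - of_nat (Suc j))"
    by (subst prod.lessThan_Suc_shift) simp
  also have "(\<Prod>j<a. t - of_nat (Suc j)) = (\<Prod>k\<in>{- int a..-1}. t + of_int k)"
    by (rule prod.reindex_bij_witness[where i = "\<lambda>k. nat (- k - 1)" and j = "\<lambda>j. - int j - 1"])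
      auto
  finally have 1: "(\<Prod>j<Suc a. t - of_nat j) = t * (\<Prod>k\<in>{- int a..-1}. t + of_int k)" .
  have 2: "(\<Prod>j<n - a. t + of_nat j) = (\<Prod>k\<in>{0..int n - int a - 1}. t + of_int k)"
    by (rule prod.reindex_bij_witness[where i = nat and j = int]) auto
  have "{- int a..int n - int a - 1} = {- int a..-1} \<union> {0..int n - int a - 1}"
    using assms by auto
  then have "H_fun n a t =
      (\<Prod>k\<in>{- int a..-1}. t + of_int k) * (\<Prod>k\<in>{0..int n - int a - 1}. t + of_int k)"
    unfolding H_fun_def by (simp only:) (rule prod.union_disjoint; auto)
  then show ?thesis by (simp only: content_poly_def 1 2 mult.assoc)
qed

text \<open>A permutation \<open>s\<close> and a column permutation \<open>q\<close> contribute
  together when they agree on the leg, that is, when \<open>s = q \<circ> rho\<close> with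
  \<open>rho\<close> permuting the first row. By \<open>ncyc_comp\<close> the cycle numbers of
  \<open>q\<close> and \<open>rho\<close> add up to one more than that of \<open>s\<close>; the
  factor \<open>t\<close> on the left absorbs this and the double sum becomes a product.\<close>

lemma central_scalar:
  assumes n: "a < n" and x: "x \<in> columns n a"
  shows "t * (\<Sum>s | s permutes {1..n}. t ^ ncyc {1..n} s *
      Poly_Mapping.lookup (column_vec n a x) (hook_tabloid n a (s \<circ> x))) = content_poly n a t"
proof -
  let ?N = "{1..n}" and ?X = "x ` {0..a}"
  \<comment> \<open>\<open>R\<close> consists of the entries of the first row, corner included, and
    meets the first column only in \<open>x 0\<close>.\<close>
  define R where "R = ?N - x ` {1..a}"
  note xD = columnsD[OF x]
  have inj: "inj_on x {1..a}" using xD(1) by (rule inj_on_subset) auto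
  have X: "?X = insert (x 0) (x ` {1..a})" by (rule columns_image_eq)
  have x0: "x 0 \<notin> x ` {1..a}" using inj_onD[OF xD(1), of 0] by fastforce
  have sub: "x 0 \<in> ?N" "x ` {1..a} \<subseteq> ?N" using xD(2) unfolding X by auto
  then have fin: "finite R" "finite ?X" and N: "R \<union> x ` {1..a} = ?N" and "x 0 \<in> R"
    using x0 by (auto simp: R_def)
  have card: "card R = n - a" "card ?X = Suc a"
    using inj xD(1) card_Diff_subset[OF _ sub(2)] by (simp_all add: R_def card_image)
  have fixing: "{s. s permutes ?N \<and> (\<forall>i\<in>{1..a}. s (x i) = x i)} = {s. s permutes R}"
  proof (intro equalityI subsetI; unfold mem_Collect_eq)
    fix s assume s: "s permutes ?N \<and> (\<forall>i\<in>{1..a}. s (x i) = x i)"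
    then show "s permutes R" by (intro permutes_superset[of s ?N R]) (auto simp: R_def)
  next
    fix s assume s: "s permutes R"
    then show "s permutes ?N \<and> (\<forall>i\<in>{1..a}. s (x i) = x i)"
      using permutes_subset[OF s, of ?N] permutes_not_in[OF s] by (auto simp: R_def)
  qed
  have inner: "t * (\<Sum>s | s permutes ?N. t ^ ncyc ?N s * of_bool (\<forall>i\<in>{1..a}. q (x i) = s (x i))) =
      t ^ ncyc ?X q * (\<Sum>s | s permutes R. t ^ ncyc R s)" if q: "q permutes ?X" for q
  proof -
    have qN: "q permutes ?N" using q xD(2) by (rule permutes_subset)
    have "(\<Sum>s | s permutes ?N. t ^ ncyc ?N s * of_bool (\<forall>i\<in>{1..a}. q (x i) = s (x i))) =
        (\<Sum>s | s permutes ?N. t ^ ncyc ?N (q \<circ> s) * of_bool (\<forall>i\<in>{1..a}. q (x i) = (q \<circ> s) (x i)))"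
      by (rule setum_permutations_compose_left[OF qN])
    also have "\<dots> = (\<Sum>s | s permutes ?N. if \<forall>i\<in>{1..a}. s (x i) = x i then t ^ ncyc ?N (q \<circ> s) else 0)"
      by (intro sum.cong refl) (auto simp: inj_eq[OF permutes_inj[OF q]])
    also have "\<dots> = (\<Sum>s | s permutes R. t ^ ncyc ?N (q \<circ> s))"
      unfolding fixing[symmetric] by (simp add: sum.If_cases finite_permutations Collect_conj_eq)
    finally have "t * (\<Sum>s | s permutes ?N. t ^ ncyc ?N s * of_bool (\<forall>i\<in>{1..a}. q (x i) = s (x i))) =
        (\<Sum>s | s permutes R. t ^ Suc (ncyc ?N (q \<circ> s)))"
      by (simp add: sum_distrib_left)
    also have "\<dots> = (\<Sum>s | s permutes R. t ^ ncyc ?X q * t ^ ncyc R s)"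
    proof (intro sum.cong refl)
      fix s assume "s \<in> {s. s permutes R}"
      then have "Suc (ncyc (R \<union> x ` {1..a}) (q \<circ> s)) = ncyc R s + ncyc (insert (x 0) (x ` {1..a})) q"
        using q fin \<open>x 0 \<in> R\<close> unfolding X by (intro ncyc_comp) (auto simp: R_def)
      then show "t ^ Suc (ncyc ?N (q \<circ> s)) = t ^ ncyc ?X q * t ^ ncyc R s"
        unfolding N X by (simp only: power_add mult.commute)
    qed
    finally show ?thesis by (simp add: sum_distrib_left)
  qed
  have "t * (\<Sum>s | s permutes ?N. t ^ ncyc ?N s *
      Poly_Mapping.lookup (column_vec n a x) (hook_tabloid n a (s \<circ> x))) =
    t * (\<Sum>s | s permutes ?N. \<Sum>q | q permutes ?X. of_int (sign q) *
      (t ^ ncyc ?N s * of_bool (\<forall>i\<in>{1..a}. q (x i) = s (x i))))"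
    unfolding lookup_column_vec by (simp only: sum_distrib_left o_apply mult.left_commute)
  also have "\<dots> = (\<Sum>q | q permutes ?X. of_int (sign q) * (t *
      (\<Sum>s | s permutes ?N. t ^ ncyc ?N s * of_bool (\<forall>i\<in>{1..a}. q (x i) = s (x i)))))"
    by (subst sum.swap) (simp only: sum_distrib_left mult.left_commute)
  also have "\<dots> = (\<Sum>q | q permutes ?X. of_int (sign q) * t ^ ncyc ?X q) *
      (\<Sum>s | s permutes R. t ^ ncyc R s)"
    unfolding sum_distrib_right[of _ _ "\<Sum>s | s permutes R. t ^ ncyc R s"]
    by (rule sum.cong[OF refl]) (simp only: mem_Collect_eq inner mult.assoc)
  also have "\<dots> = content_poly n a t"
    unfolding content_poly_def sum_sign_power_ncyc[OF fin(2)] sum_power_ncyc[OF fin(1)] card ..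
  finally show ?thesis .
qed

text \<open>Conjugating \<open>s\<close> by each column permutation \<open>p\<close> preserves the
  cycle number and moves the signed column sum to the left of \<open>s\<close>. There
  \<open>signed_column_sum\<close> returns a multiple of the original vector, whose factor is found
  by cancelling \<open>t\<close> in \<open>central_scalar\<close>.\<close>

lemma sum_act_column_vec:
  assumes n: "a < n" and x: "x \<in> columns n a" and t: "t \<noteq> 0"
  shows "(\<Sum>s | s permutes {1..n}. scale_vec (t ^ ncyc {1..n} s) (act s (column_vec n a x))) =
    scale_vec (H_fun n a t) (column_vec n a x)"
proof -
  let ?N = "{1..n}" and ?X = "x ` {0..a}"
  have "(\<Sum>s | s permutes ?N. scale_vec (t ^ ncyc ?N s) (act s (column_vec n a x))) =
      (\<Sum>p | p permutes ?X. \<Sum>s | s permutes ?N.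
        Poly_Mapping.single (hook_tabloid n a (s \<circ> (p \<circ> x))) (t ^ ncyc ?N s * of_int (sign p)))"
    by (subst sum.swap, intro sum.cong refl)
      (simp add: column_vec_def act_sum tabloid_space.scale_sum_right map_image_hook_tabloid)
  also have "\<dots> = (\<Sum>p | p permutes ?X. \<Sum>s | s permutes ?N.
        Poly_Mapping.single (hook_tabloid n a (p \<circ> (s \<circ> x))) (t ^ ncyc ?N s * of_int (sign p)))"
  proof (rule sum.cong[OF refl])
    fix p assume "p \<in> {p. p permutes ?X}"
    then have p: "p permutes ?N" using permutes_subset[OF _ columnsD(2)[OF x]] by simp
    note p' = permutes_inv[OF p]
    show "(\<Sum>s | s permutes ?N.
        Poly_Mapping.single (hook_tabloid n a (s \<circ> (p \<circ> x))) (t ^ ncyc ?N s * of_int (sign p))) =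
      (\<Sum>s | s permutes ?N.
        Poly_Mapping.single (hook_tabloid n a (p \<circ> (s \<circ> x))) (t ^ ncyc ?N s * of_int (sign p)))"
    proof (rule sum.reindex_bij_witness[where j = "\<lambda>s. inv p \<circ> s \<circ> p" and i = "\<lambda>s. p \<circ> s \<circ> inv p"])
      fix s assume "s \<in> {s. s permutes ?N}"
      then have s: "s permutes ?N" by simp
      show "p \<circ> (inv p \<circ> s \<circ> p) \<circ> inv p = s" "inv p \<circ> (p \<circ> s \<circ> inv p) \<circ> p = s"
        using permutes_inverses[OF p] by (simp_all add: fun_eq_iff)
      show "inv p \<circ> s \<circ> p \<in> {s. s permutes ?N}" "p \<circ> s \<circ> inv p \<in> {s. s permutes ?N}"
        using s p p' by (auto intro!: permutes_compose)
      have "ncyc ?N (inv p \<circ> s \<circ> p) = ncyc ?N s"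
        using ncyc_conj[OF _ s p'] permutes_inv_inv[OF p] by simp
      moreover have "p \<circ> (inv p \<circ> s \<circ> p \<circ> x) = s \<circ> (p \<circ> x)"
        using permutes_inverses[OF p] by (simp add: fun_eq_iff)
      ultimately show "Poly_Mapping.single (hook_tabloid n a (p \<circ> (inv p \<circ> s \<circ> p \<circ> x)))
          (t ^ ncyc ?N (inv p \<circ> s \<circ> p) * of_int (sign p)) =
        Poly_Mapping.single (hook_tabloid n a (s \<circ> (p \<circ> x))) (t ^ ncyc ?N s * of_int (sign p))"
        by (simp only:)
    qed
  qed
  also have "\<dots> = (\<Sum>s | s permutes ?N. scale_vec (t ^ ncyc ?N s) (\<Sum>p | p permutes ?X.
        Poly_Mapping.single (hook_tabloid n a (p \<circ> (s \<circ> x))) (of_int (sign p))))"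
    by (subst sum.swap) (simp add: tabloid_space.scale_sum_right)
  also have "\<dots> = (\<Sum>s | s permutes ?N. scale_vec (t ^ ncyc ?N s *
      Poly_Mapping.lookup (column_vec n a x) (hook_tabloid n a (s \<circ> x))) (column_vec n a x))"
    by (intro sum.cong refl) (simp add: signed_column_sum[OF x comp_in_columns[OF x]])
  also have "\<dots> = scale_vec (\<Sum>s | s permutes ?N. t ^ ncyc ?N s *
      Poly_Mapping.lookup (column_vec n a x) (hook_tabloid n a (s \<circ> x))) (column_vec n a x)"
    by (simp only: tabloid_space.scale_sum_left)
  also have "(\<Sum>s | s permutes ?N. t ^ ncyc ?N s *
      Poly_Mapping.lookup (column_vec n a x) (hook_tabloid n a (s \<circ> x))) = H_fun n a t"
    using central_scalar[OF n x, of t] content_poly_eq_H_fun[OF n, of t] t by simp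
  finally show ?thesis .
qed

lemma sum_act_specht_hook:
  assumes "a < n" "v \<in> specht (hook n a)" "t \<noteq> 0"
  shows "(\<Sum>s | s permutes {1..n}. scale_vec (t ^ ncyc {1..n} s) (act s v)) = scale_vec (H_fun n a t) v"
  using assms(1,2)
proof (induction rule: specht_hook_induct)
  case zero
  then show ?case using module_hom.zero[OF module_hom_act] by simp
next
  case (add c x w)
  have "(\<Sum>s | s permutes {1..n}. scale_vec (t ^ ncyc {1..n} s) (act s (scale_vec c (column_vec n a x) + w))) =
    scale_vec c (\<Sum>s | s permutes {1..n}. scale_vec (t ^ ncyc {1..n} s) (act s (column_vec n a x))) +
    (\<Sum>s | s permutes {1..n}. scale_vec (t ^ ncyc {1..n} s) (act s w))"
    by (simp add: act_add act_scale tabloid_space.scale_right_distrib sum.distrib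
        tabloid_space.scale_sum_right mult.commute)
  also have "\<dots> = scale_vec (H_fun n a t) (scale_vec c (column_vec n a x) + w)"
    unfolding sum_act_column_vec[OF assms(1) add(1) assms(3)] add(2)
    by (simp add: tabloid_space.scale_right_distrib mult.commute)
  finally show ?case .
qed

text \<open>The central element acts as a scalar on the translates by \<open>g\<close> of the basis
  vectors, and the diagonal coefficients then give the trace of its product with
  \<open>g\<close>.\<close>

lemma sum_specht_character_hook:
  assumes n: "a < n" and g: "g permutes {1..n}" and t: "t \<noteq> 0"
  shows "(\<Sum>s | s permutes {1..n}. t ^ ncyc {1..n} s * specht_character (hook n a) (s \<circ> g)) =
    H_fun n a t * specht_character (hook n a) g"
proof -
  let ?e = "\<lambda>Y. column_vec n a (corner_column Y)" and ?k = "\<lambda>Y. hook_tabloid n a (corner_column Y)"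
  have char: "specht_character (hook n a) h =
      (\<Sum>Y\<in>legs n a. Poly_Mapping.lookup (act h (?e Y)) (?k Y))" if "h permutes {1..n}" for h
    unfolding specht_character_def
    by (rule trace_on_specht_hook[OF n module_hom_act act_in_specht[OF n that]])
  have e: "act g (?e Y) \<in> specht (hook n a)" if "Y \<in> legs n a" for Y
    using act_in_specht[OF n g column_vec_in_specht[OF n corner_column(1)[OF n that]]] .
  have "(\<Sum>s | s permutes {1..n}. t ^ ncyc {1..n} s * specht_character (hook n a) (s \<circ> g)) =
    (\<Sum>s | s permutes {1..n}. \<Sum>Y\<in>legs n a.
      Poly_Mapping.lookup (scale_vec (t ^ ncyc {1..n} s) (act s (act g (?e Y)))) (?k Y))"
  proof (intro sum.cong refl)
    fix s assume "s \<in> {s. s permutes {1..n}}"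
    then have "s \<circ> g permutes {1..n}" using permutes_compose[OF g] by simp
    then show "t ^ ncyc {1..n} s * specht_character (hook n a) (s \<circ> g) = (\<Sum>Y\<in>legs n a.
        Poly_Mapping.lookup (scale_vec (t ^ ncyc {1..n} s) (act s (act g (?e Y)))) (?k Y))"
      by (simp add: char act_act sum_distrib_left)
  qed
  also have "\<dots> = (\<Sum>Y\<in>legs n a. Poly_Mapping.lookup
      (\<Sum>s | s permutes {1..n}. scale_vec (t ^ ncyc {1..n} s) (act s (act g (?e Y)))) (?k Y))"
    by (subst sum.swap) (simp only: lookup_sum)
  also have "\<dots> = (\<Sum>Y\<in>legs n a. H_fun n a t * Poly_Mapping.lookup (act g (?e Y)) (?k Y))"
  proof (rule sum.cong[OF refl])
    fix Y assume Y: "Y \<in> legs n a"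
    show "Poly_Mapping.lookup (\<Sum>s | s permutes {1..n}.
        scale_vec (t ^ ncyc {1..n} s) (act s (act g (?e Y)))) (?k Y) =
      H_fun n a t * Poly_Mapping.lookup (act g (?e Y)) (?k Y)"
      unfolding sum_act_specht_hook[OF n e[OF Y] t] lookup_scale_vec ..
  qed
  finally show ?thesis by (simp add: char[OF g] sum_distrib_left)
qed

section \<open>The alternating sum of the hook characters\<close>

text \<open>The size of the orbit is the first return time \<open>funpow_dist1 p x x\<close>, so the
  earlier powers list the orbit without repetition.\<close>

lemma orbit_enumeration:
  assumes "p permutes S" "finite S"
  shows "bij_betw (\<lambda>i. (p ^^ i) x) {0..<card (orbit p x)} (orbit p x)"
    and "(p ^^ card (orbit p x)) x = x"
proof -
  let ?d = "funpow_dist1 p x x"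
  have x: "x \<in> orbit p x" by (rule self_in_orbit_permutes[OF assms])
  have eq: "orbit p x = (\<lambda>i. (p ^^ i) x) ` {0..<?d}"
    by (rule orbit_conv_funpow_dist1[OF x])
  have inj: "inj_on (\<lambda>i. (p ^^ i) x) {0..<?d}" by (rule inj_on_funpow_dist1[OF x])
  then have "card (orbit p x) = card {0..<?d}" by (subst eq) (rule card_image)
  then have d: "card (orbit p x) = ?d" by simp
  show "bij_betw (\<lambda>i. (p ^^ i) x) {0..<card (orbit p x)} (orbit p x)"
    unfolding d bij_betw_def using inj eq by blast
  show "(p ^^ card (orbit p x)) x = x"
    unfolding d by (rule funpow_dist1_prop[OF x])
qed

text \<open>With \<open>f = inv g\<close> these are the index pairs of
  \<open>specht_character_hook\<close> for all leg sizes together: the condition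
  \<open>g (p y) = y\<close> becomes agreement of \<open>p\<close> with \<open>f\<close> on the
  leg.\<close>

definition legged_perms :: "nat \<Rightarrow> (nat \<Rightarrow> nat) \<Rightarrow> (nat set \<times> (nat \<Rightarrow> nat)) set" where
  "legged_perms n f = {(Y, p). Y \<subseteq> {2..n} \<and> p permutes insert 1 Y \<and> (\<forall>y\<in>Y. p y = f y)}"

lemma finite_legged_perms: "finite (legged_perms n f)"
proof (rule finite_subset)
  show "legged_perms n f \<subseteq> (SIGMA Y:Pow {2..n}. {p. p permutes insert 1 Y})"
    by (auto simp: legged_perms_def)
  have "finite (insert 1 Y)" if "Y \<in> Pow {2..n}" for Y :: "nat set"
    using that finite_subset[of Y "{2..n}"] by simp
  then show "finite (SIGMA Y:Pow {2..n}. {p. p permutes insert 1 Y})"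
    by (intro finite_SigmaI finite_permutations) simp_all
qed

lemma legged_permsD:
  assumes "(Y, p) \<in> legged_perms n f"
  shows "Y \<subseteq> {2..n}" "finite Y" "1 \<notin> Y" "p permutes insert 1 Y"
    "\<And>y. y \<in> Y \<Longrightarrow> p y = f y" "\<And>y. y \<in> Y \<Longrightarrow> f y \<in> insert 1 Y"
proof -
  show Y: "Y \<subseteq> {2..n}" and p: "p permutes insert 1 Y" using assms by (auto simp: legged_perms_def)
  show "finite Y" "1 \<notin> Y" using Y finite_subset[of Y "{2..n}"] by auto
  show *: "p y = f y" if "y \<in> Y" for y using assms that by (auto simp: legged_perms_def)
  show "f y \<in> insert 1 Y" if "y \<in> Y" for y
    using permutes_in_image[OF p, of y] *[OF that] that by simp
qed

lemma alternating_sum_legged_perms: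
  assumes n: "1 \<le> n" and g: "g permutes {1..n}"
  shows "(\<Sum>a = 0..n - 1. (- 1) ^ a * specht_character (hook n a) g) =
    (\<Sum>(Y, p)\<in>legged_perms n (inv g). (- 1) ^ card Y * of_int (sign p))"
proof -
  let ?f = "inv g"
  define A where "A Y = {p. p permutes insert 1 Y \<and> (\<forall>y\<in>Y. p y = ?f y)}" for Y
  have finA: "finite (A Y)" if "Y \<subseteq> {2..n}" for Y
    using that finite_subset[of Y "{2..n}"] unfolding A_def
    by (intro finite_subset[OF _ finite_permutations[of "insert 1 Y"]]) auto
  have "(\<Sum>a = 0..n - 1. (- 1) ^ a * specht_character (hook n a) g) =
      (\<Sum>a = 0..n - 1. \<Sum>Y\<in>legs n a. \<Sum>p\<in>A Y. (- 1) ^ card Y * of_int (sign p))"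
  proof (rule sum.cong[OF refl])
    fix a assume "a \<in> {0..n - 1}"
    then have "a < n" using n by auto
    have "(g (p y) = y) = (p y = ?f y)" for p :: "nat \<Rightarrow> nat" and y
      using permutes_inv_eq[OF g] by metis
    then have "specht_character (hook n a) g = (\<Sum>Y\<in>legs n a. \<Sum>p\<in>A Y. of_int (sign p))"
      unfolding specht_character_hook[OF \<open>a < n\<close> g] A_def by simp
    then show "(- 1) ^ a * specht_character (hook n a) g =
        (\<Sum>Y\<in>legs n a. \<Sum>p\<in>A Y. (- 1) ^ card Y * of_int (sign p))"
      by (simp add: sum_distrib_left legs_def)
  qed
  also have "\<dots> = (\<Sum>Y\<in>(\<Union>a\<in>{0..n - 1}. legs n a). \<Sum>p\<in>A Y. (- 1) ^ card Y * of_int (sign p))"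
    by (rule sum.UNION_disjoint[symmetric]) (auto simp: finite_legs legs_def)
  also have "(\<Union>a\<in>{0..n - 1}. legs n a) = Pow {2..n}"
  proof -
    have "card Y \<in> {0..n - 1}" if "Y \<subseteq> {2..n}" for Y
      using card_mono[OF _ that] n by simp
    then show ?thesis by (auto simp: legs_def)
  qed
  also have "(\<Sum>Y\<in>Pow {2..n}. \<Sum>p\<in>A Y. (- 1) ^ card Y * of_int (sign p)) =
      (\<Sum>(Y, p)\<in>(SIGMA Y:Pow {2..n}. A Y). (- 1) ^ card Y * of_int (sign p) :: complex)"
    by (rule sum.Sigma) (use finA in auto)
  also have "(SIGMA Y:Pow {2..n}. A Y) = legged_perms n ?f"
    by (auto simp: legged_perms_def A_def)
  finally show ?thesis .
qed

text \<open>A cycle that avoids 1 can be toggled in \<open>Y\<close>, which reverses the sign.\<close>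

lemma sum_legged_perms_eq_0:
  assumes f: "f permutes {1..n}" and z: "z \<in> {1..n}" "1 \<notin> orbit f z"
  shows "(\<Sum>(Y, p)\<in>legged_perms n f. (- 1) ^ card Y * of_int (sign p)) = (0 :: complex)"
proof -
  define c where "c = orbit f z"
  define r where "r = perm_restrict f c"
  define w where "w = (\<lambda>(Y, p). (- 1) ^ card (Y :: nat set) * of_int (sign (p :: nat \<Rightarrow> nat)) :: complex)"
  let ?L0 = "{(Y, p) \<in> legged_perms n f. Y \<inter> c = {}}" and ?L1 = "{(Y, p) \<in> legged_perms n f. c \<subseteq> Y}"
  have cn: "c \<subseteq> {1..n}" unfolding c_def by (rule permutes_orbit_subset[OF f z(1)])
  have c2: "c \<subseteq> {2..n}"
  proof
    fix y assume "y \<in> c"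
    then have "y \<in> {1..n}" "y \<noteq> 1" using cn z(2) unfolding c_def by blast+
    then show "y \<in> {2..n}" by simp
  qed
  have fin: "finite c" using cn finite_subset by blast
  have cyc: "cyclic_on f c" unfolding c_def by (rule cyclic_on_orbit[OF f]) simp
  have fc: "f y \<in> c" if "y \<in> c" for y using cyclic_on_inI[OF cyc that] .
  have r: "r permutes c"
    unfolding r_def
    by (rule inj_imp_permutes)
      (auto simp: perm_restrict_def fin fc inj_on_def inj_eq[OF permutes_inj[OF f]])
  note r' = permutes_inv[OF r]
  have rc: "r y = f y" if "y \<in> c" for y using that by (simp add: r_def perm_restrict_def)
  have "cyclic_on r c" using cyc by (simp add: r_def cyclic_on_perm_restrict)
  then have "orbit r ` c = {c}" unfolding cyclic_on_alldef by blast
  \<comment> \<open>Adding the cycle changes \<open>card Y\<close> by \<open>card c\<close> and the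
    sign of \<open>p\<close> by that of \<open>r\<close>. Together these give the factor -1.\<close>
  then have sign_r: "sign r = (- 1) ^ Suc (card c)"
    using sign_eq_ncyc[OF fin r] by (simp add: ncyc_def)
  have perm_r: "permutation r" using r fin permutation_permutes by blast
  \<comment> \<open>A leg is closed under \<open>f\<close> except for steps to 1, and
    \<open>c\<close> avoids 1. A leg that meets the cycle \<open>c\<close> therefore contains all of
    it.\<close>
  have dichotomy: "Y \<inter> c = {} \<or> c \<subseteq> Y" if L: "(Y, p) \<in> legged_perms n f" for Y p
  proof (cases "Y \<inter> c = {}")
    case False
    then obtain y where y: "y \<in> Y" "y \<in> c" by blast
    have "orbit f y \<subseteq> Y \<inter> c"
    proof (rule orbit_subsetI)
      fix u assume u: "u \<in> Y \<inter> c"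
      then have "f u \<in> insert 1 Y" "f u \<in> c" using legged_permsD(6)[OF L] fc by auto
      moreover have "1 \<notin> c" using z(2) c_def by simp
      ultimately show "f u \<in> Y \<inter> c" by auto
    qed (use y in simp)
    moreover have "orbit f y = c" using cyc y(2) by (rule orbit_cyclic_eq3)
    ultimately show ?thesis by blast
  qed simp
  have "(\<Sum>x\<in>legged_perms n f. w x) = (\<Sum>x\<in>?L0 \<union> ?L1. w x)"
    by (rule sum.cong) (use dichotomy in auto)
  also have "\<dots> = (\<Sum>x\<in>?L0. w x) + (\<Sum>x\<in>?L1. w x)"
  proof (rule sum.union_disjoint)
    have "c \<noteq> {}" unfolding c_def by (rule orbit_nonempty)
    then show "?L0 \<inter> ?L1 = {}" by auto
  qed (rule finite_subset[OF _ finite_legged_perms]; blast)+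
  also have "(\<Sum>x\<in>?L0. w x) = (\<Sum>x\<in>?L1. - w x)"
  \<comment> \<open>When \<open>c\<close> is disjoint from the leg, \<open>p\<close> fixes its
    letters, so multiplying by \<open>r\<close> on the right makes \<open>p\<close> agree with
    \<open>f\<close> on \<open>c\<close> and changes nothing on the leg. Multiplying by
    \<open>inv r\<close> undoes this.\<close>
  proof (rule sum.reindex_bij_witness[where j = "\<lambda>(Y, p). (Y \<union> c, p \<circ> r)"
        and i = "\<lambda>(Y, p). (Y - c, p \<circ> inv r)"])
    fix x assume "x \<in> ?L0"
    then obtain Y p where x: "x = (Y, p)" and L: "(Y, p) \<in> legged_perms n f" and disj: "Y \<inter> c = {}"
      by auto
    note D = legged_permsD[OF L]
    have "p \<circ> r permutes insert 1 (Y \<union> c)"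
      by (intro permutes_compose permutes_subset[OF r] permutes_subset[OF D(4)]) auto
    moreover have "(p \<circ> r) y = f y" if "y \<in> Y \<union> c" for y
    proof (cases "y \<in> c")
      case True
      then have "f y \<notin> insert 1 Y" using fc[OF True] disj c2 by auto
      then show ?thesis using permutes_not_in[OF D(4)] rc[OF True] by simp
    next
      case False
      then show ?thesis using that permutes_not_in[OF r False] D(5) by simp
    qed
    ultimately show "(case x of (Y, p) \<Rightarrow> (Y \<union> c, p \<circ> r)) \<in> ?L1"
      using D(1) c2 by (simp add: x legged_perms_def)
    have "Y \<union> c - c = Y" using disj by blast
    then show "(case case x of (Y, p) \<Rightarrow> (Y \<union> c, p \<circ> r) of (Y, p) \<Rightarrow> (Y - c, p \<circ> inv r)) = x"
      by (simp add: x comp_assoc permutes_inv_o[OF r] del: o_apply)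
    have "permutation p" using D(2) by (intro permutes_imp_permutation[OF _ D(4)]) simp
    moreover have "card (Y \<union> c) = card Y + card c" using disj D(2) fin by (intro card_Un_disjoint)
    ultimately show "- w (case x of (Y, p) \<Rightarrow> (Y \<union> c, p \<circ> r)) = w x"
      by (simp add: w_def x sign_compose[OF _ perm_r] sign_r minus_one_power_iff)
  next
    fix x assume "x \<in> ?L1"
    then obtain Y p where x: "x = (Y, p)" and L: "(Y, p) \<in> legged_perms n f" and sub: "c \<subseteq> Y"
      by auto
    note D = legged_permsD[OF L]
    have "p \<circ> inv r permutes insert 1 Y"
      using sub by (intro permutes_compose permutes_subset[OF r'] D(4)) auto
    then have "p \<circ> inv r permutes insert 1 (Y - c)"
    proof (rule permutes_superset)
      fix y assume "y \<in> insert 1 Y - insert 1 (Y - c)"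
      then have "inv r y \<in> c" using permutes_in_image[OF r'] by auto
      then have "p (inv r y) = r (inv r y)" using D(5) sub rc by auto
      then show "(p \<circ> inv r) y = y" using permutes_inverses[OF r] by simp
    qed
    moreover have "(p \<circ> inv r) y = f y" if "y \<in> Y - c" for y
      using that permutes_not_in[OF r'] D(5) by simp
    ultimately show "(case x of (Y, p) \<Rightarrow> (Y - c, p \<circ> inv r)) \<in> ?L0"
      using D(1) by (auto simp: x legged_perms_def)
    have "Y - c \<union> c = Y" using sub by blast
    then show "(case case x of (Y, p) \<Rightarrow> (Y - c, p \<circ> inv r) of (Y, p) \<Rightarrow> (Y \<union> c, p \<circ> r)) = x"
      by (simp add: x comp_assoc permutes_inv_o[OF r] del: o_apply)
  qed
  finally show ?thesis by (simp add: w_def sum_negf)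
qed

lemma upward_closed_eq:
  assumes "K \<subseteq> {0..<n}" "\<And>i j. i \<in> K \<Longrightarrow> i \<le> j \<Longrightarrow> j < n \<Longrightarrow> j \<in> K"
  shows "K = {n - card K..<n :: nat}"
proof (cases "K = {}")
  case False
  have fin: "finite K" using assms(1) finite_subset by blast
  have "K = {Min K..<n}"
  proof (intro equalityI subsetI)
    show "i \<in> {Min K..<n}" if "i \<in> K" for i
      using that assms(1) Min_le[OF fin that] by auto
    show "i \<in> K" if "i \<in> {Min K..<n}" for i
      using assms(2)[OF Min_in[OF fin False], of i] that by simp
  qed
  moreover have "Min K < n" using Min_in[OF fin False] assms(1) by auto
  ultimately have "card K = n - Min K" by (metis card_atLeastLessThan)
  then have "n - card K = Min K" using \<open>Min K < n\<close> by simp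
  then show ?thesis using \<open>K = {Min K..<n}\<close> by (simp only:)
qed simp

text \<open>When the cycle is listed from 1 as \<open>e 0\<close>, ..., \<open>e (n - 1)\<close>, a
  leg must be a final segment, and each size below \<open>n\<close> occurs exactly once. The
  matching \<open>p\<close> is a single cycle on \<open>insert 1 Y\<close>, whose sign cancels the
  factor from \<open>card Y\<close>.\<close>

lemma sum_legged_perms_eq_n:
  assumes f: "f permutes {1..n}" and n: "1 \<le> n" and orb: "orbit f 1 = {1..n}"
  shows "(\<Sum>(Y, p)\<in>legged_perms n f. (- 1) ^ card Y * of_int (sign p)) = (of_nat n :: complex)"
proof -
  define e where "e i = (f ^^ i) 1" for i
  have card1: "card (orbit f 1) = n" by (subst orb) simp
  have e: "bij_betw e {0..<n} {1..n}" and en: "e n = 1"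
    using orbit_enumeration[OF f finite_atLeastAtMost, of 1] unfolding card1 unfolding orb e_def
    by simp_all
  have e_inj: "inj_on e {0..<n}" using e by (rule bij_betw_imp_inj_on)
  have einj: "i = j" if "e i = e j" "i < n" "j < n" for i j
    using inj_onD[OF e_inj that(1)] that by simp
  have e0: "e 0 = 1" and eS: "e (Suc i) = f (e i)" for i by (simp_all add: e_def)
  have shape: "Y = e ` {n - card Y..<n}" "card Y < n" if L: "(Y, p) \<in> legged_perms n f" for Y p
  proof -
    note D = legged_permsD[OF L]
    define K where "K = {i. i < n \<and> e i \<in> Y}"
    have "Y \<subseteq> e ` {0..<n}" using D(1) e by (auto simp: bij_betw_def)
    then have Y: "Y = e ` K" by (auto simp: K_def)
    have up: "e j \<in> Y" if "e i \<in> Y" "i \<le> j" "j < n" for i j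
      using that(2,3)
    proof (induction j rule: dec_induct)
      case (step j)
      \<comment> \<open>The walk returns to 1 only after \<open>n\<close> steps; before that, the
        image of a leg entry stays in the leg.\<close>
      have "e (Suc j) \<noteq> 1" using einj[of "Suc j" 0] step e0 n by auto
      then show ?case using step D(6)[of "e j"] by (auto simp: eS)
    qed (use that in simp)
    have sub: "K \<subseteq> {0..<n}" by (auto simp: K_def)
    have K: "K = {n - card K..<n}"
    proof (rule upward_closed_eq)
      show "j \<in> K" if "i \<in> K" "i \<le> j" "j < n" for i j
        using up[of i j] that by (simp add: K_def)
    qed (rule sub)
    have card: "card Y = card K"
      unfolding Y by (rule card_image[OF inj_on_subset[OF e_inj sub]])
    show "Y = e ` {n - card Y..<n}"
      unfolding card by (rule trans[OF Y arg_cong[OF K, of "(`) e"]])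
    show "card Y < n" using card_mono[OF _ D(1)] n by simp
  qed
  have "bij_betw (\<lambda>(Y, p). card Y) (legged_perms n f) {0..<n}"
  proof (rule bij_betwI')
    fix x y assume "x \<in> legged_perms n f" "y \<in> legged_perms n f"
    then obtain Y p Y' p' where xy: "x = (Y, p)" "y = (Y', p')"
      and L: "(Y, p) \<in> legged_perms n f" and L': "(Y', p') \<in> legged_perms n f"
      by (cases x; cases y) simp
    show "((case x of (Y, p) \<Rightarrow> card Y) = (case y of (Y, p) \<Rightarrow> card Y)) = (x = y)"
    proof
      assume "(case x of (Y, p) \<Rightarrow> card Y) = (case y of (Y, p) \<Rightarrow> card Y)"
      then have "card Y = card Y'" by (simp add: xy)
      then have "e ` {n - card Y..<n} = e ` {n - card Y'..<n}" by (simp only:)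
      then have "Y = Y'" using shape(1)[OF L] shape(1)[OF L'] by (rule box_equals[OF _ sym sym])
      moreover have "p = p'"
        using legged_permsD[OF L] legged_permsD[OF L'] \<open>Y = Y'\<close>
        by (intro permutes_insert_eqI[of p 1 Y p']) simp_all
      ultimately show "x = y" by (simp add: xy)
    qed simp
  next
    fix x assume "x \<in> legged_perms n f"
    then show "(case x of (Y, p) \<Rightarrow> card Y) \<in> {0..<n}" by (cases x) (simp add: shape(2))
  next
    fix a assume a: "a \<in> {0..<n}"
    define Y where "Y = e ` {n - a..<n}"
    have "inj_on e {n - a..<n}" using e_inj by (rule inj_on_subset) auto
    then have card: "card Y = a" using a by (simp add: Y_def card_image)
    have "e i \<in> {2..n}" if "i \<in> {n - a..<n}" for i
    proof -
      have "e i \<in> {1..n}" using that e by (auto simp: bij_betw_def)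
      moreover have "e i \<noteq> 1" using einj[of i 0] e0 that a by auto
      ultimately show ?thesis by auto
    qed
    then have sub: "Y \<subseteq> {2..n}" by (auto simp: Y_def)
    have "f (e i) \<in> insert 1 Y" if "i \<in> {n - a..<n}" for i
    \<comment> \<open>The last entry of the segment is sent to 1, so \<open>f\<close> maps
      \<open>Y\<close> into \<open>insert 1 Y\<close> rather than into \<open>Y\<close>.\<close>
    proof (cases "Suc i = n")
      case True
      then show ?thesis using en eS[of i] by simp
    next
      case False
      then have "e (Suc i) \<in> Y" using that unfolding Y_def by (intro imageI) auto
      then show ?thesis using eS by simp
    qed
    then have "f ` Y \<subseteq> insert 1 Y" unfolding Y_def by blast
    moreover have "finite (insert 1 Y)" by (simp add: Y_def)
    ultimately obtain p where "p permutes insert 1 Y" "\<And>y. y \<in> Y \<Longrightarrow> p y = f y"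
      using permutes_extension[of "insert 1 Y" Y f] permutes_inj_on[OF f] subset_insertI by blast
    then have "(Y, p) \<in> legged_perms n f" using sub by (simp add: legged_perms_def)
    then show "\<exists>x\<in>legged_perms n f. a = (case x of (Y, p) \<Rightarrow> card Y)" using card by (intro bexI[of _ "(Y, p)"]) simp_all
  qed
  then have count: "card (legged_perms n f) = n" using bij_betw_same_card by fastforce
  have weight: "(- 1) ^ card Y * of_int (sign p) = (1 :: complex)"
    if L: "(Y, p) \<in> legged_perms n f" for Y p
  proof -
    note D = legged_permsD[OF L]
    have fin: "finite (insert 1 Y)" using D(2) by simp
    \<comment> \<open>A cycle of \<open>p\<close> avoiding 1 would lie in the leg, where
      \<open>p\<close> agrees with \<open>f\<close>, and would thus be a cycle of \<open>f\<close>
      avoiding 1.\<close>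
    have "orbit p y = orbit p 1" if y: "y \<in> insert 1 Y" for y
    proof (rule ccontr)
      assume "orbit p y \<noteq> orbit p 1"
      then have "1 \<notin> orbit p y" using orbit_eqI_permutes[OF D(4) fin, of 1 y] by auto
      moreover have "orbit p y \<subseteq> insert 1 Y" by (rule permutes_orbit_subset[OF D(4) y])
      ultimately have "orbit p y \<subseteq> Y" by blast
      then have "orbit f y = orbit p y"
        using D(5) by (intro orbit_cong self_in_orbit_permutes[OF D(4) fin]) auto
      moreover have "y \<in> orbit f 1" using y D(1) n unfolding orb by auto
      then have "orbit f y = orbit f 1" by (rule orbit_eqI_permutes[OF f, rotated]) simp
      ultimately show False using \<open>1 \<notin> orbit p y\<close> n orb by auto
    qed
    then have "orbit p ` insert 1 Y = (\<lambda>_. orbit p 1) ` insert 1 Y" by (rule image_cong[OF refl])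
    then have "orbit p ` insert 1 Y = {orbit p 1}" by (simp only: image_constant_conv) simp
    then have "ncyc (insert 1 Y) p = 1" by (simp only: ncyc_def is_singletonI is_singleton_altdef[symmetric])
    then have "sign p = (- 1) ^ (card (insert 1 Y) + 1)"
      using sign_eq_ncyc[OF fin D(4)] by (simp only:)
    then have "sign p = (- 1) ^ card Y" using D(2,3) by simp
    then show ?thesis by (simp add: minus_one_power_iff)
  qed
  have "(\<Sum>(Y, p)\<in>legged_perms n f. (- 1) ^ card Y * of_int (sign p)) =
      (\<Sum>x\<in>legged_perms n f. 1 :: complex)"
    by (rule sum.cong[OF refl]) (use weight in auto)
  then show ?thesis using count by simp
qed

text \<open>If the cycle through 1 is not everything, some letter \<open>z\<close> lies on a cycle
  avoiding 1, and toggling that cycle kills the sum. The legged permutations belong to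
  \<open>inv g\<close>, which has the same orbits as \<open>g\<close>.\<close>

lemma alternating_sum_hook_characters:
  assumes n: "1 \<le> n" and g: "g permutes {1..n}"
  shows "(\<Sum>a = 0..n - 1. (- 1) ^ a * specht_character (hook n a) g) =
    (if orbit g 1 = {1..n} then of_nat n else 0)"
proof -
  have f: "inv g permutes {1..n}" using g by (rule permutes_inv)
  have orb: "orbit (inv g) x = orbit g x" for x
    using g permutation_permutes by (intro orbit_inv_eq) auto
  have one: "(1 :: nat) \<in> {1..n}" using n by simp
  show ?thesis
  proof (cases "orbit g 1 = {1..n}")
    case True
    then show ?thesis
      using sum_legged_perms_eq_n[OF f n] alternating_sum_legged_perms[OF n g] orb by simp
  next
    case False
    then obtain z where z: "z \<in> {1..n}" "z \<notin> orbit g 1"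
      using permutes_orbit_subset[OF g one] by blast
    have "1 \<notin> orbit (inv g) z"
    proof
      assume "1 \<in> orbit (inv g) z"
      then have "orbit g 1 = orbit g z" using orbit_eqI_permutes[OF g] orb by auto
      then show False using z(2) self_in_orbit_permutes[OF g, of z] by simp
    qed
    then show ?thesis
      using sum_legged_perms_eq_0[OF f z(1)] alternating_sum_legged_perms[OF n g] False by simp
  qed
qed

section \<open>Cycle types and conjugacy\<close>

lemma conj_class_cyc:
  assumes "p \<in> conj_class n lam"
  shows "cyc n p = length lam"
proof -
  have "size (cycle_type n p) = size (mset lam)" using assms by (simp add: conj_class_def)
  then show ?thesis by (simp add: cycle_type_def cyc_def)
qed

lemma conj_class_permutes: "p \<in> conj_class n lam \<Longrightarrow> p permutes {1..n}"
  by (simp add: conj_class_def)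

lemma finite_conj_class: "finite (conj_class n lam)"
  using finite_subset[OF _ finite_permutations[of "{1..n}"], of "conj_class n lam"]
  by (auto simp: conj_class_def)

lemma conj_class_full_cycle:
  assumes n: "1 \<le> n"
  shows "p \<in> conj_class n [n] \<longleftrightarrow> p permutes {1..n} \<and> orbit p 1 = {1..n}"
proof
  assume p: "p \<in> conj_class n [n]"
  then have perm: "p permutes {1..n}" by (rule conj_class_permutes)
  have type: "image_mset card (mset_set (cycle_sets n p)) = {#n#}"
    using p by (simp add: conj_class_def cycle_type_def)
  have "orbit p 1 \<in> cycle_sets n p" using n by (simp add: cycle_sets_def)
  moreover have "finite (cycle_sets n p)" by (simp add: cycle_sets_def)
  ultimately have "card (orbit p 1) \<in># image_mset card (mset_set (cycle_sets n p))" by simp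
  then have "card (orbit p 1) = card {1..n}" unfolding type by simp
  moreover have "orbit p 1 \<subseteq> {1..n}" using permutes_orbit_subset[OF perm] n by simp
  ultimately show "p permutes {1..n} \<and> orbit p 1 = {1..n}"
    using perm card_subset_eq[of "{1..n}" "orbit p 1"] by simp
next
  assume p: "p permutes {1..n} \<and> orbit p 1 = {1..n}"
  then have "orbit p x = {1..n}" if "x \<in> {1..n}" for x
    using orbit_eqI_permutes[of p "{1..n}" x 1] that by simp
  then have "cycle_sets n p = {{1..n}}" using n by (auto simp: cycle_sets_def)
  then show "p \<in> conj_class n [n]" using p by (simp add: conj_class_def cycle_type_def)
qed

text \<open>The two cycles are matched position by position, starting from \<open>x\<close> and
  \<open>y\<close>.\<close>

lemma orbit_intertwiner:
  assumes p: "p permutes S" and q: "q permutes S" and S: "finite S"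
    and card: "card (orbit p x) = card (orbit q y)"
  shows "\<exists>h. bij_betw h (orbit p x) (orbit q y) \<and> (\<forall>z\<in>orbit p x. h (p z) = q (h z))"
proof -
  let ?d = "card (orbit p x)"
  let ?e = "\<lambda>i. (p ^^ i) x" and ?e' = "\<lambda>i. (q ^^ i) y"
  note e = orbit_enumeration[OF p S, of x]
  note e' = orbit_enumeration[OF q S, of y, folded card]
  define h where "h = ?e' \<circ> the_inv_into {0..<?d} ?e"
  have h: "h (?e i) = ?e' i" if "i < ?d" for i
    using the_inv_into_f_f[OF bij_betw_imp_inj_on[OF e(1)], of i] that by (simp add: h_def)
  have "bij_betw h (orbit p x) (orbit q y)"
    unfolding h_def by (rule bij_betw_trans[OF bij_betw_the_inv_into[OF e(1)] e'(1)])
  moreover have "h (p z) = q (h z)" if "z \<in> orbit p x" for z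
  proof -
    have "z \<in> ?e ` {0..<?d}" using that bij_betw_imp_surj_on[OF e(1)] by simp
    then obtain i where i: "i < ?d" "z = ?e i" by auto
    show ?thesis
    proof (cases "Suc i = ?d")
      \<comment> \<open>At the last position both cycles close up and return to their starting
        points.\<close>
      case True
      have "p z = ?e 0" using e(2) i(2) by (simp flip: True)
      moreover have "q (h z) = ?e' 0" using e'(2) h[OF i(1)] i(2) by (simp flip: True)
      moreover have "h (?e 0) = ?e' 0" by (rule h) (use i in simp)
      ultimately show ?thesis by simp
    next
      case False
      then have "h (?e (Suc i)) = ?e' (Suc i)" using i(1) by (intro h) simp
      then show ?thesis using i h[OF i(1)] by simp
    qed
  qed
  ultimately show ?thesis by blast
qed

text \<open>An arbitrary bijection \<open>b\<close> between the cycles is corrected by a permutation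
  \<open>s\<close> of the cycles of \<open>p\<close>, which exists because the multisets of lengths
  agree.\<close>

lemma cycle_sets_bijection:
  assumes "cycle_type n p = cycle_type n q"
  obtains F where "bij_betw F (cycle_sets n p) (cycle_sets n q)"
    "\<And>c. c \<in> cycle_sets n p \<Longrightarrow> card (F c) = card c"
proof -
  let ?C = "cycle_sets n p" and ?D = "cycle_sets n q"
  have fin: "finite ?C" "finite ?D" by (simp_all add: cycle_sets_def)
  have "card ?C = card ?D" using arg_cong[OF assms, of size] by (simp add: cycle_type_def)
  then obtain b where b: "bij_betw b ?C ?D" using finite_same_card_bij[OF fin] by blast
  have "image_mset b (mset_set ?C) = mset_set ?D"
    using b by (metis bij_betw_imp_inj_on bij_betw_imp_surj_on image_mset_mset_set)
  then have "image_mset (card \<circ> b) (mset_set ?C) = image_mset card (mset_set ?D)"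
    by (simp flip: multiset.map_comp)
  then have "image_mset card (mset_set ?C) = image_mset (card \<circ> b) (mset_set ?C)"
    using assms by (simp add: cycle_type_def)
  then obtain s where s: "s permutes ?C" "\<forall>c\<in>?C. card c = (card \<circ> b) (s c)"
    using image_mset_eq_implies_permutes[OF fin(1), of card "card \<circ> b"] by blast
  have "bij_betw (b \<circ> s) ?C ?D" using bij_betw_trans[OF permutes_imp_bij[OF s(1)] b] .
  then show thesis using that s(2) by simp
qed

text \<open>The conjugating permutation is glued from intertwiners of matched cycles and is the
  identity outside \<open>{1..n}\<close>.\<close>

lemma same_cycle_type_conj:
  assumes p: "p permutes {1..n}" and q: "q permutes {1..n}"
    and type: "cycle_type n p = cycle_type n q"
  obtains h where "h permutes {1..n}" "q = h \<circ> p \<circ> inv h"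
proof -
  let ?N = "{1..n}"
  obtain F where F: "bij_betw F (cycle_sets n p) (cycle_sets n q)"
    "\<And>c. c \<in> cycle_sets n p \<Longrightarrow> card (F c) = card c"
    using cycle_sets_bijection[OF type] by metis
  have "\<exists>h. bij_betw h c (F c) \<and> (\<forall>z\<in>c. h (p z) = q (h z))" if c: "c \<in> cycle_sets n p" for c
  proof -
    obtain x where "c = orbit p x" using c by (auto simp: cycle_sets_def)
    moreover have "F c \<in> cycle_sets n q" using bij_betwE[OF F(1)] c by blast
    then obtain y where "F c = orbit q y" by (auto simp: cycle_sets_def)
    ultimately show ?thesis using orbit_intertwiner[OF p q, of x y] F(2)[OF c] by simp
  qed
  then obtain H where H: "\<And>c. c \<in> cycle_sets n p \<Longrightarrow> bij_betw (H c) c (F c)"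
    "\<And>c z. c \<in> cycle_sets n p \<Longrightarrow> z \<in> c \<Longrightarrow> H c (p z) = q (H c z)"
    by metis
  define h where "h x = (if x \<in> ?N then H (orbit p x) x else x)" for x
  have cyc: "orbit p x \<in> cycle_sets n p" if "x \<in> ?N" for x
    using that by (simp add: cycle_sets_def)
  have self: "x \<in> orbit p x" for x by (rule self_in_orbit_permutes[OF p]) simp
  have hF: "h x \<in> F (orbit p x)" if "x \<in> ?N" for x
    using bij_betwE[OF H(1)[OF cyc[OF that]]] self that by (simp add: h_def)
  have FD: "F (orbit p x) \<in> cycle_sets n q" if "x \<in> ?N" for x
    using bij_betwE[OF F(1)] cyc[OF that] by blast
  \<comment> \<open>The value \<open>h x\<close> determines the matched cycle and hence the cycle of
    \<open>x\<close>, which reduces injectivity of \<open>h\<close> to that of a single piece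
    \<open>H c\<close>.\<close>
  have Forb: "F (orbit p x) = orbit q (h x)" if x: "x \<in> ?N" for x
  proof -
    obtain y where y: "F (orbit p x) = orbit q y" using FD[OF x] by (auto simp: cycle_sets_def)
    then show ?thesis using orbit_eqI_permutes[OF q _, of "h x" y] hF[OF x] by simp
  qed
  have h: "h permutes ?N"
  proof (rule inj_imp_permutes)
    show "inj_on h ?N"
    proof (rule inj_onI)
      fix x y assume xy: "x \<in> ?N" "y \<in> ?N" "h x = h y"
      then have "F (orbit p x) = F (orbit p y)" using Forb by simp
      then have eq: "orbit p x = orbit p y"
        using inj_onD[OF bij_betw_imp_inj_on[OF F(1)]] cyc xy by blast
      have "H (orbit p x) x = H (orbit p x) y" using xy eq by (simp add: h_def)
      then show "x = y"
        using inj_onD[OF bij_betw_imp_inj_on[OF H(1)[OF cyc[OF xy(1)]]]] self eq by metis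
    qed
    show "h x \<in> ?N" if x: "x \<in> ?N" for x
    proof -
      obtain y where "y \<in> ?N" "F (orbit p x) = orbit q y"
        using FD[OF x] by (auto simp: cycle_sets_def)
      then show ?thesis using hF[OF x] permutes_orbit_subset[OF q] by blast
    qed
  qed (auto simp: h_def)
  have comm: "h (p x) = q (h x)" for x
  proof (cases "x \<in> ?N")
    case True
    then have "p x \<in> ?N" using permutes_in_image[OF p] by blast
    moreover have "orbit p (p x) = orbit p x"
      by (rule permutation_orbit_step[OF permutes_imp_permutation[OF _ p]]) simp
    ultimately show ?thesis using True H(2)[OF cyc[OF True] self] by (simp add: h_def)
  next
    case False
    then have "h x = x" unfolding h_def by (rule if_not_P)
    then show ?thesis using permutes_not_in[OF p False] permutes_not_in[OF q False] by simp
  qed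
  have "q = h \<circ> p \<circ> inv h"
    by (rule ext) (simp add: comm permutes_inverses[OF h])
  with h show thesis by (rule that)
qed

lemma irr_char_hook:
  assumes "a < n" "sum_list lam = n" "p \<in> conj_class n lam"
  shows "irr_char (hook n a) lam = specht_character (hook n a) p"
proof -
  define q where "q = (SOME p. p \<in> conj_class n lam)"
  have q: "q \<in> conj_class n lam" unfolding q_def 
    by (rule someI[of "\<lambda>p. p \<in> conj_class n lam"]) (rule assms(3))
  then have "cycle_type n p = cycle_type n q" using assms(3) by (simp add: conj_class_def)
  then obtain h where "h permutes {1..n}" "q = h \<circ> p \<circ> inv h"
    using same_cycle_type_conj conj_class_permutes[OF q] conj_class_permutes[OF assms(3)] by metis
  then show ?thesis
    using specht_character_hook_conj[OF assms(1) conj_class_permutes[OF assms(3)]] assms(2)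
    by (simp add: irr_char_def flip: q_def)
qed

section \<open>Counting factorizations\<close>

abbreviation prod_perms :: "('a \<Rightarrow> 'a) list \<Rightarrow> 'a \<Rightarrow> 'a" where
  "prod_perms ss \<equiv> foldr (\<circ>) ss id"

lemma prod_perms_Cons: "prod_perms (s # ss) = s \<circ> prod_perms ss"
  by simp

definition perm_lists :: "nat \<Rightarrow> nat \<Rightarrow> (nat \<Rightarrow> nat) list set" where
  "perm_lists n k = {ts. length ts = k \<and> (\<forall>s\<in>set ts. s permutes {1..n})}"

lemma perm_lists_Suc:
  "perm_lists n (Suc k) = (\<lambda>(ts, s). s # ts) ` (perm_lists n k \<times> {s. s permutes {1..n}})"
  by (auto simp: perm_lists_def length_Suc_conv image_iff)

lemma finite_perm_lists: "finite (perm_lists n k)"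
proof (induction k)
  case 0
  have "perm_lists n 0 = {[]}" by (auto simp: perm_lists_def)
  then show ?case by simp
next
  case (Suc k)
  then show ?case by (simp add: perm_lists_Suc finite_permutations)
qed

lemma prod_perms_permutes:
  assumes "\<forall>s\<in>set ss. s permutes S"
  shows "prod_perms ss permutes S"
  using assms
proof (induction ss)
  case (Cons s ss)
  have "prod_perms ss permutes S" by (rule Cons.IH) (use Cons.prems in simp)
  then show ?case unfolding prod_perms_Cons
    by (rule permutes_compose) (use Cons.prems in simp)
qed (simp add: permutes_id)

text \<open>This parity computation is used to show that the genus is an integer.\<close>

lemma sign_prod_perms:
  assumes "\<forall>s\<in>set ss. s permutes {1..n}"
  shows "sign (prod_perms ss) = (- 1) ^ (length ss * n + (\<Sum>s\<leftarrow>ss. cyc n s))"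
  using assms
proof (induction ss)
  case (Cons s ss)
  have "sign (s \<circ> prod_perms ss) = sign s * sign (prod_perms ss)"
    using Cons.prems prod_perms_permutes[of ss "{1..n}"]
    by (intro sign_compose_permutes[of "{1..n}"]) simp_all
  moreover have "sign s = (- 1) ^ (n + cyc n s)"
    using sign_eq_ncyc[of "{1..n}" s] Cons.prems by (simp add: cyc_eq_ncyc)
  moreover have "sign (prod_perms ss) = (- 1) ^ (length ss * n + (\<Sum>s\<leftarrow>ss. cyc n s))"
    by (rule Cons.IH) (use Cons.prems in simp)
  ultimately show ?case
    unfolding prod_perms_Cons by (simp add: power_add mult_ac del: foldr_Cons o_apply)
qed simp

text \<open>Peeling off the first entry of the list applies the central element once and yields one
  factor \<open>H_fun n a t\<close>.\<close>

lemma sum_perm_lists_hook_character: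
  assumes a: "a < n" and t: "t \<noteq> 0" and g: "g permutes {1..n}"
  shows "(\<Sum>ts\<in>perm_lists n k. t ^ (\<Sum>s\<leftarrow>ts. cyc n s) *
      specht_character (hook n a) (prod_perms ts \<circ> g)) =
    H_fun n a t ^ k * specht_character (hook n a) g"
proof (induction k)
  case 0
  have "perm_lists n 0 = {[]}" by (auto simp: perm_lists_def)
  then show ?case by simp
next
  case (Suc k)
  let ?chi = "specht_character (hook n a)" and ?w = "\<lambda>ts. t ^ (\<Sum>s\<leftarrow>ts. cyc n s)"
  have "inj_on (\<lambda>(ts, s). s # ts) (perm_lists n k \<times> {s. s permutes {1..n}})"
    by (auto simp: inj_on_def)
  then have "(\<Sum>ts\<in>perm_lists n (Suc k). ?w ts * ?chi (prod_perms ts \<circ> g)) =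
      (\<Sum>(ts, s)\<in>perm_lists n k \<times> {s. s permutes {1..n}}.
        ?w (s # ts) * ?chi (prod_perms (s # ts) \<circ> g))"
    by (simp add: perm_lists_Suc sum.reindex case_prod_unfold)
  also have "\<dots> = (\<Sum>ts\<in>perm_lists n k. \<Sum>s | s permutes {1..n}.
      ?w (s # ts) * ?chi (prod_perms (s # ts) \<circ> g))"
    by (rule sum.cartesian_product[symmetric])
  also have "\<dots> = (\<Sum>ts\<in>perm_lists n k. H_fun n a t * (?w ts * ?chi (prod_perms ts \<circ> g)))"
  proof (rule sum.cong[OF refl])
    fix ts assume "ts \<in> perm_lists n k"
    then have "prod_perms ts permutes {1..n}"
      by (intro prod_perms_permutes) (simp add: perm_lists_def)
    then have "prod_perms ts \<circ> g permutes {1..n}" by (rule permutes_compose[OF g])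
    then have "H_fun n a t * ?chi (prod_perms ts \<circ> g) =
        (\<Sum>s | s permutes {1..n}. t ^ cyc n s * ?chi (s \<circ> (prod_perms ts \<circ> g)))"
      unfolding cyc_eq_ncyc by (rule sum_specht_character_hook[OF a _ t, symmetric])
    then have "H_fun n a t * (?w ts * ?chi (prod_perms ts \<circ> g)) =
        (\<Sum>s | s permutes {1..n}. ?w ts * (t ^ cyc n s * ?chi (s \<circ> (prod_perms ts \<circ> g))))"
      by (simp only: mult.left_commute[of _ "?w ts"] sum_distrib_left[symmetric])
    then show "(\<Sum>s | s permutes {1..n}. ?w (s # ts) * ?chi (prod_perms (s # ts) \<circ> g)) =
        H_fun n a t * (?w ts * ?chi (prod_perms ts \<circ> g))"
      unfolding prod_perms_Cons comp_assoc by (simp add: power_add mult_ac del: o_apply)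
  qed
  also have "\<dots> = H_fun n a t ^ Suc k * ?chi g"
    unfolding sum_distrib_left[symmetric] Suc by simp
  finally show ?case .
qed

text \<open>The alternating sum of hook characters detects full cycles. After the interchange of
  sums, each hook is handled separately by \<open>sum_perm_lists_hook_character\<close>.\<close>

lemma sum_full_cycle_hook_characters:
  assumes n: "1 \<le> n" and t: "t \<noteq> 0" and phi: "phi permutes {1..n}"
  shows "(\<Sum>ts | ts \<in> perm_lists n k \<and> orbit (prod_perms ts \<circ> phi) 1 = {1..n}.
      t ^ (\<Sum>s\<leftarrow>ts. cyc n s)) =
    1 / of_nat n * (\<Sum>a = 0..n - 1. (- 1) ^ a * H_fun n a t ^ k * specht_character (hook n a) phi)"
proof -
  let ?chi = "\<lambda>a. specht_character (hook n a)" and ?w = "\<lambda>ts. t ^ (\<Sum>s\<leftarrow>ts. cyc n s)"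
  have "(\<Sum>ts | ts \<in> perm_lists n k \<and> orbit (prod_perms ts \<circ> phi) 1 = {1..n}. ?w ts) =
      (\<Sum>ts\<in>perm_lists n k. if orbit (prod_perms ts \<circ> phi) 1 = {1..n} then ?w ts else 0)"
    using finite_perm_lists[of n k] by (simp only: sum.inter_filter)
  also have "\<dots> = (\<Sum>ts\<in>perm_lists n k. 1 / of_nat n * (\<Sum>a = 0..n - 1.
      (- 1) ^ a * (?w ts * ?chi a (prod_perms ts \<circ> phi))))"
  proof (rule sum.cong[OF refl])
    fix ts assume "ts \<in> perm_lists n k"
    then have "prod_perms ts permutes {1..n}"
      by (intro prod_perms_permutes) (simp add: perm_lists_def)
    then have "prod_perms ts \<circ> phi permutes {1..n}" by (rule permutes_compose[OF phi])
    note alternating_sum_hook_characters[OF n this]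
    moreover have "(\<Sum>a = 0..n - 1. (- 1) ^ a * (?w ts * ?chi a (prod_perms ts \<circ> phi))) =
        ?w ts * (\<Sum>a = 0..n - 1. (- 1) ^ a * ?chi a (prod_perms ts \<circ> phi))"
      by (simp only: sum_distrib_left mult.left_commute)
    ultimately show "(if orbit (prod_perms ts \<circ> phi) 1 = {1..n} then ?w ts else 0) =
        1 / of_nat n * (\<Sum>a = 0..n - 1. (- 1) ^ a * (?w ts * ?chi a (prod_perms ts \<circ> phi)))"
      using n by simp
  qed
  also have "\<dots> = 1 / of_nat n * (\<Sum>a = 0..n - 1. (- 1) ^ a *
      (\<Sum>ts\<in>perm_lists n k. ?w ts * ?chi a (prod_perms ts \<circ> phi)))"
    unfolding sum_distrib_left[of "1 / of_nat n", symmetric]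
    by (subst sum.swap) (simp only: sum_distrib_left)
  also have "\<dots> = 1 / of_nat n * (\<Sum>a = 0..n - 1. (- 1) ^ a * H_fun n a t ^ k * ?chi a phi)"
  proof -
    have "(\<Sum>ts\<in>perm_lists n k. ?w ts * ?chi a (prod_perms ts \<circ> phi)) = H_fun n a t ^ k * ?chi a phi"
      if "a \<in> {0..n - 1}" for a
      using that n by (intro sum_perm_lists_hook_character t phi) simp
    then show ?thesis by (simp only: mult.assoc cong: sum.cong)
  qed
  finally show ?thesis .
qed

text \<open>Rotating the product relation cyclically expresses the first entry as the inverse of
  \<open>prod_perms (tl ss) \<circ> phi\<close>. Inversion preserves orbits, so the full-cycle
  condition passes to this product.\<close>

lemma Maps_full_cycleD:
  assumes n: "1 \<le> n" and M: "(phi, ss) \<in> Maps (Suc k) n lam"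
  shows "phi \<in> conj_class n lam" "\<forall>s\<in>set ss. s permutes {1..n}"
    "ss = inv (prod_perms (tl ss) \<circ> phi) # tl ss" "tl ss \<in> perm_lists n k"
    "orbit (prod_perms (tl ss) \<circ> phi) 1 = {1..n}" "cyc n (hd ss) = 1"
proof -
  show phi: "phi \<in> conj_class n lam" and ss: "\<forall>s\<in>set ss. s permutes {1..n}"
    using M by (simp_all add: Maps_def)
  obtain s ts where s: "ss = s # ts" using M by (cases ss) (simp_all add: Maps_def)
  show "tl ss \<in> perm_lists n k" using M by (simp add: Maps_def perm_lists_def s)
  have full: "s \<in> conj_class n [n]" and id: "phi \<circ> (s \<circ> prod_perms ts) = id"
    using M unfolding Maps_def s prod_perms_Cons by simp_all
  have perm: "prod_perms ts permutes {1..n}" using ss by (intro prod_perms_permutes) (simp add: s)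
  note p = conj_class_permutes[OF phi]
  let ?g = "prod_perms ts \<circ> phi"
  have g: "?g permutes {1..n}" using p perm by (rule permutes_compose)
  have "s (?g x) = x" for x
  proof -
    have "phi (s (?g x)) = phi x" using fun_cong[OF id, of "phi x"] by simp
    then show ?thesis using permutes_inj[OF p] by (simp add: inj_eq)
  qed
  then have s_eq: "s = inv ?g"
    using permutes_inverses(1)[OF g] by (intro ext) metis
  then show "ss = inv (prod_perms (tl ss) \<circ> phi) # tl ss" by (simp add: s)
  have "orbit (inv ?g) 1 = orbit ?g 1"
    by (rule orbit_inv_eq[OF permutes_imp_permutation[OF _ g]]) simp
  then show "orbit (prod_perms (tl ss) \<circ> phi) 1 = {1..n}"
    using full s_eq by (simp add: s conj_class_full_cycle[OF n])
  show "cyc n (hd ss) = 1" using conj_class_cyc[OF full] by (simp add: s)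
qed

text \<open>The first entry has exactly one cycle, so \<open>k * n + 1\<close> minus twice the genus
  is \<open>length lam\<close> plus the cycle numbers of the tail.\<close>

lemma power_genus:
  fixes t :: complex
  assumes n: "1 \<le> n" and t: "t \<noteq> 0" and M: "(phi, ss) \<in> Maps (Suc k) n lam"
  shows "t ^ (k * n + 1) * (t powi (- 2)) powi \<lfloor>genus (Suc k) n lam (phi, ss)\<rfloor> =
    t ^ length lam * t ^ (\<Sum>s\<leftarrow>tl ss. cyc n s)"
proof -
  note D = Maps_full_cycleD[OF n M]
  have len: "length ss = Suc k" and id: "phi \<circ> prod_perms ss = id"
    using M by (simp_all add: Maps_def)
  let ?c = "\<Sum>s\<leftarrow>tl ss. cyc n s" and ?l = "length lam"
  have c: "(\<Sum>s\<leftarrow>ss. cyc n s) = Suc ?c"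
    using D(6) len by (cases ss) simp_all
  \<comment> \<open>Comparing signs in the product relation gives the parity that makes the genus
    equal to the integer \<open>z\<close> below, so that the floor is exact.\<close>
  have "sign phi * sign (prod_perms ss) = 1"
    using sign_compose_permutes[of "{1..n}" phi "prod_perms ss"] conj_class_permutes[OF D(1)]
      prod_perms_permutes[OF D(2)] id by simp
  moreover have "sign phi = (- 1) ^ (n + ?l)"
    using sign_eq_ncyc[of "{1..n}" phi] conj_class_permutes[OF D(1)] conj_class_cyc[OF D(1)]
    by (simp add: cyc_eq_ncyc)
  ultimately have "(- 1 :: int) ^ (n + ?l + (Suc k * n + Suc ?c)) = 1"
    unfolding sign_prod_perms[OF D(2)] len c by (simp only: power_add)
  then have "even (n + ?l + (Suc k * n + Suc ?c))" by (simp add: minus_one_power_iff split: if_splits)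
  moreover have "n + ?l + (Suc k * n + Suc ?c) = 2 * n + (k * n + ?l + ?c + 1)" by simp
  ultimately have "even (k * n + ?l + ?c + 1)" by (metis dvd_add_right_iff dvd_triv_left)
  then have "even (int (k * n + ?l + ?c + 1))" by (simp only: even_of_nat)
  then have "even (int (k * n) + int ?l + int ?c + 1)" by (simp only: of_nat_add of_nat_1)
  then obtain d where d: "int (k * n) + int ?l + int ?c + 1 = 2 * d" by (elim evenE)
  define z where "z = d - int ?l - int ?c"
  have z: "2 * z = int (k * n) + 1 - int ?l - int ?c" using d by (simp add: z_def)
  have "(\<Sum>i<Suc k. (of_nat (cyc n (ss ! i)) :: rat)) = of_nat (\<Sum>s\<leftarrow>ss. cyc n s)"
    using len by (simp add: sum_list_sum_nth atLeast0LessThan)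
  then have "genus (Suc k) n lam (phi, ss) =
      1 + 1 / 2 * (of_nat (k * n) - of_nat ?l - of_nat (Suc ?c))"
    by (simp only: genus_def snd_conv c) simp
  also have "\<dots> = of_int z"
    using arg_cong[OF z, of "of_int :: int \<Rightarrow> rat"] by (simp add: field_simps)
  finally have floor: "\<lfloor>genus (Suc k) n lam (phi, ss)\<rfloor> = z" by simp
  have "t ^ (k * n + 1) * (t powi (- 2)) powi \<lfloor>genus (Suc k) n lam (phi, ss)\<rfloor> =
      t powi int (k * n + 1) * t powi ((- 2) * z)"
    unfolding floor power_int_of_nat power_int_mult[of t "- 2" z] ..
  also have "\<dots> = t powi (int (k * n + 1) + (- 2) * z)"
    by (rule power_int_add[symmetric]) (use t in simp)
  also have "int (k * n + 1) + (- 2) * z = int (?l + ?c)" using z by simp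
  finally show ?thesis by (simp only: power_int_of_nat power_add)
qed

theorem theorem2p3:
  fixes m n :: nat and lam :: "nat list" and t :: complex
  assumes "2 \<le> m" and "1 \<le> n" and "is_partition lam n"
  shows "P_fun m n lam t =
    of_nat (card (conj_class n lam)) / of_nat n * t ^ length lam *
      (\<Sum>a = 0..n - 1. (- 1) ^ a * H_fun n a t ^ (m - 1) * irr_char (hook n a) lam)"
proof (cases "t = 0")
  case True
  \<comment> \<open>At \<open>t = 0\<close> the left side vanishes by its positive power of
    \<open>t\<close>, the right side because a partition of a positive number has at least one
    part.\<close>
  have "lam \<noteq> []" using assms(2,3) by (auto simp: is_partition_def)
  then show ?thesis using True by (simp add: P_fun_def)
next
  case t: False
  obtain k where m: "m = Suc k" using assms(1) by (cases m) auto
  note n = assms(2)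
  have sum_lam: "sum_list lam = n" using assms(3) by (simp add: is_partition_def)
  let ?C = "conj_class n lam" and ?w = "\<lambda>ts. t ^ (\<Sum>s\<leftarrow>ts. cyc n s)"
  let ?T = "\<lambda>phi. {ts. ts \<in> perm_lists n k \<and> orbit (prod_perms ts \<circ> phi) 1 = {1..n}}"
  have finT: "finite (?T phi)" for phi
    by (rule finite_subset[OF _ finite_perm_lists[of n k]]) blast
  have "P_fun m n lam t = (\<Sum>M\<in>Maps m n lam.
      t ^ (k * n + 1) * (t powi (- 2)) powi \<lfloor>genus m n lam M\<rfloor>)"
    by (simp only: P_fun_def Gamma_fun_def sum_distrib_left m diff_Suc_1)
  also have "\<dots> = (\<Sum>(phi, ts)\<in>(SIGMA phi:?C. ?T phi). t ^ length lam * ?w ts)"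
  \<comment> \<open>A factorization is determined by \<open>phi\<close> and the tail: the first
    entry is forgotten in one direction and recovered as an inverse in the other.\<close>
  proof (rule sum.reindex_bij_witness[where j = "\<lambda>(phi, ss). (phi, tl ss)"
        and i = "\<lambda>(phi, ts). (phi, inv (prod_perms ts \<circ> phi) # ts)"])
    fix M assume "M \<in> Maps m n lam"
    then obtain phi ss where M: "M = (phi, ss)" and ss: "(phi, ss) \<in> Maps (Suc k) n lam"
      unfolding m by (cases M) simp
    note D = Maps_full_cycleD[OF n ss]
    show "(case case M of (phi, ss) \<Rightarrow> (phi, tl ss) of
        (phi, ts) \<Rightarrow> (phi, inv (prod_perms ts \<circ> phi) # ts)) = M"
      unfolding M prod.case using D(3) by simp
    show "(case M of (phi, ss) \<Rightarrow> (phi, tl ss)) \<in> (SIGMA phi:?C. ?T phi)"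
      unfolding M prod.case using D(1,4,5) by blast
    show "(case case M of (phi, ss) \<Rightarrow> (phi, tl ss) of (phi, ts) \<Rightarrow> t ^ length lam * ?w ts) =
        t ^ (k * n + 1) * (t powi (- 2)) powi \<lfloor>genus m n lam M\<rfloor>"
      unfolding M m prod.case power_genus[OF n t ss] ..
  next
    fix x assume "x \<in> (SIGMA phi:?C. ?T phi)"
    then obtain phi ts where x: "x = (phi, ts)" and phi: "phi \<in> ?C" and ts: "ts \<in> perm_lists n k"
      and orb: "orbit (prod_perms ts \<circ> phi) 1 = {1..n}" by blast
    let ?g = "prod_perms ts \<circ> phi"
    have "\<forall>s\<in>set ts. s permutes {1..n}" using ts by (simp add: perm_lists_def)
    then have perm: "prod_perms ts permutes {1..n}" by (rule prod_perms_permutes)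
    note p = conj_class_permutes[OF phi]
    have g: "?g permutes {1..n}" using p perm by (rule permutes_compose)
    have inv: "inv ?g permutes {1..n}" using g by (rule permutes_inv)
    have "orbit (inv ?g) 1 = orbit ?g 1"
      by (rule orbit_inv_eq[OF permutes_imp_permutation[OF _ g]]) simp
    then have "inv ?g \<in> conj_class n [n]" using inv orb conj_class_full_cycle[OF n] by simp
    moreover have "phi \<circ> (inv ?g \<circ> prod_perms ts) = id"
    proof
      fix y
      have "inv ?g (prod_perms ts (phi (inv phi y))) = inv phi y"
        using permutes_inverses(2)[OF g, of "inv phi y"] by simp
      then show "(phi \<circ> (inv ?g \<circ> prod_perms ts)) y = id y"
        using permutes_inverses(1)[OF p] by simp
    qed
    ultimately have "(phi, inv ?g # ts) \<in> Maps (Suc k) n lam"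
      using phi ts inv
      by (simp add: Maps_def perm_lists_def prod_perms_Cons del: o_apply foldr_Cons)
    then show "(case x of (phi, ts) \<Rightarrow> (phi, inv (prod_perms ts \<circ> phi) # ts)) \<in> Maps m n lam"
      unfolding x m prod.case .
    show "(case case x of (phi, ts) \<Rightarrow> (phi, inv (prod_perms ts \<circ> phi) # ts) of
        (phi, ss) \<Rightarrow> (phi, tl ss)) = x"
      unfolding x prod.case list.sel ..
  qed
  also have "\<dots> = (\<Sum>phi\<in>?C. t ^ length lam * (\<Sum>ts\<in>?T phi. ?w ts))"
    using finT by (subst sum.Sigma[symmetric]) (simp_all add: finite_conj_class sum_distrib_left)
  also have "\<dots> = (\<Sum>phi\<in>?C. t ^ length lam * (1 / of_nat n *
      (\<Sum>a = 0..n - 1. (- 1) ^ a * H_fun n a t ^ k * irr_char (hook n a) lam)))"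
  proof (rule sum.cong[OF refl])
    fix phi assume phi: "phi \<in> ?C"
    \<comment> \<open>Hook characters depend only on the class, so all \<open>phi\<close> contribute
      equally and the sum over \<open>?C\<close> turns into its cardinality.\<close>
    have "(\<Sum>a = 0..n - 1. (- 1) ^ a * H_fun n a t ^ k * specht_character (hook n a) phi) =
        (\<Sum>a = 0..n - 1. (- 1) ^ a * H_fun n a t ^ k * irr_char (hook n a) lam)"
      using n irr_char_hook[OF _ sum_lam phi] by (intro sum.cong refl) simp
    then show "t ^ length lam * (\<Sum>ts\<in>?T phi. ?w ts) = t ^ length lam * (1 / of_nat n *
        (\<Sum>a = 0..n - 1. (- 1) ^ a * H_fun n a t ^ k * irr_char (hook n a) lam))"
      unfolding sum_full_cycle_hook_characters[OF n t conj_class_permutes[OF phi]] by simp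
  qed
  finally show ?thesis by (simp add: m)
qed

end
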